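(* Let $(Y,\mathcal{E})$ be an object of $\mathbf{Sh}(\mathsf{Sp}_f)$. Then $(Y,\mathcal{E})$ is a sober sheaf for the front topology if and only if the topological space $Y$ is sober.
   Context: **The category $\mathbf{Sh}(\mathsf{Sp}_f)$.** For a topological space $Y$, $Y_f$ is the set $Y$ with the front topology, which has as basis the locally closed subsets (intersections of an open and a closed subset) of $Y$. Objects of $\mathbf{Sh}(\mathsf{Sp}_f)$ are pairs $(Y,\mathcal{E})$ with $Y$ a topological space and $\mathcal{E}$ a sheaf of sets on $Y_f$ with $\mathcal{E}(Y_f)\ne\varnothing$. Morphisms $(Y,\mathcal{E})\to(Y',\mathcal{E}')$ are pairs $(f,\lambda)$ with $f:Y\to Y'$ continuous (hence also continuous as a map $Y_f\to Y'_f$) and $\lambda:\mathcal{E}'\to f_*\mathcal{E}$ a morphism of sheaves on $Y'_f$. **The skew lattice $H(Y,\mathcal{E})$.** $H(Y,\mathcal{E})$ is the set of pairs $(U,s)$ with $U\subseteq Y$ open in the original topology of $Y$ and $s\in\mathcal{E}(U)$, with $(U,s)\wedge(V,t)=(U\cap V,s|_{U\cap V})$ and $(U,s)\vee(V,t)=(U\cup V,\,s|_{U-V}\cup t)$, where $s|_{U-V}\cup t$ is the unique section over $U\cup V$ restricting to $s|_{U-V}$ on $U-V$ and to $t$ on $V$. It is a left-handed noncommutative frame (a kind of skew lattice), with Green's relation $a\,\mathcal{D}\,b$ iff $a\wedge b\wedge a=a$ and $b\wedge a\wedge b=b$; here $(U,s)\,\mathcal{D}\,(V,t)$ iff $U=V$,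 so $H(Y,\mathcal{E})/\mathcal{D}\cong\mathcal{O}(Y)$. **The object $G(A)$.** For a left-handed noncommutative frame $A$ (such as $A=H(Y,\mathcal{E})$), $A/\mathcal{D}$ is a frame, and $G(A)=(Y_A,\mathcal{E}_A)$ is the following object of $\mathbf{Sh}(\mathsf{Sp}_f)$. $Y_A=\mathrm{pt}(A/\mathcal{D})$ is the set of frame homomorphisms $p:A/\mathcal{D}\to\mathbf{2}=\{0,1\}$, with open sets $U_a=\{p: p(a)=1\}$, $a\in A$ (where $p(a)$ is the value of $p$ on the class of $a$). For $p\in Y_A$ and $a,b\in A$ with $p(a)=p(b)=1$, put $a\sim_p b$ iff there are $c,d\in A$ with $p(c)=0$, $p(d)=1$ and $(a\wedge d)\vee c=(b\wedge d)\vee c$; this is an equivalence relation. Let $E_A=\{(p,[a]_{\sim_p}): p\in Y_A, a\in A, p(a)=1\}$, $\pi_A(p,[a]_{\sim_p})=p$, and $s_a:U_a\to E_A$, $s_a(p)=(p,[a]_{\sim_p})$. Give $E_A$ the topology generated by the sets $s_a(Z)$ with $a\in A$ and $Z\subseteq U_a$ locally closed in $Y_A$. Then $\mathcal{E}_A$ is the sheaf on $(Y_A)_f$ of continuous sections of $\pi_A:E_A\to (Y_A)_f$; every section of $\mathcal{E}_A$ is locally of the form $s_a$. **Sobriety.** $(Y,\mathcal{E})$ is called a sober sheaf for the front topology if the natural morphism $(f,\lambda):(Y,\mathcal{E})\to G(H(Y,\mathcal{E}))$ is an isomorphism in $\mathbf{Sh}(\mathsf{Sp}_f)$, where $f:Y\to\mathrm{pt}(\mathcal{O}(Y))$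 sends $p$ to $\hat p$ with $\hat p(U)=1$ iff $p\in U$, and $\lambda:\mathcal{E}_{H(Y,\mathcal{E})}\to f_*\mathcal{E}$ is determined by $s_a\mapsto s$ for $a=(U,s)\in H(Y,\mathcal{E})$. A topological space $Y$ is sober if it is homeomorphic to $\mathrm{pt}(L)$ for some frame $L$; equivalently, each irreducible closed subset has a unique generic point. *)

theory Defs
  imports "HOL-Analysis.Abstract_Topology" "HOL-Algebra.Complete_Lattice"
begin

section \<open>Frames and their spaces of points\<close>

locale frame = complete_lattice +
  assumes meet_sup_distrib:
    "\<lbrakk>a \<in> carrier L; S \<subseteq> carrier L\<rbrakk> \<Longrightarrow> a \<sqinter> \<Squnion>S = \<Squnion>((\<lambda>s. a \<sqinter> s) ` S)"

definition frame_hom :: "'a gorder \<Rightarrow> 'b gorder \<Rightarrow> ('a \<Rightarrow> 'b) \<Rightarrow> bool" where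
  "frame_hom L M h \<longleftrightarrow>
     h \<in> carrier L \<rightarrow> carrier M \<and>
     h \<top>\<^bsub>L\<^esub> = \<top>\<^bsub>M\<^esub> \<and>
     (\<forall>a\<in>carrier L. \<forall>b\<in>carrier L. h (a \<sqinter>\<^bsub>L\<^esub> b) = h a \<sqinter>\<^bsub>M\<^esub> h b) \<and>
     (\<forall>S\<subseteq>carrier L. h (\<Squnion>\<^bsub>L\<^esub>S) = \<Squnion>\<^bsub>M\<^esub>(h ` S))"

definition two :: "bool gorder" where
  "two = \<lparr>carrier = UNIV, eq = (=), le = (\<le>)\<rparr>"

text \<open>Points are extensional functions, so that each frame homomorphism is represented once.\<close>

definition points :: "'a gorder \<Rightarrow> ('a \<Rightarrow> bool) set" where
  "points L = {p \<in> extensional (carrier L). frame_hom L two p}"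

definition pt_open :: "'a gorder \<Rightarrow> 'a \<Rightarrow> ('a \<Rightarrow> bool) set" where
  "pt_open L a = {p \<in> points L. p a}"

definition pt :: "'a gorder \<Rightarrow> ('a \<Rightarrow> bool) topology" where
  "pt L = topology (\<lambda>W. \<exists>a\<in>carrier L. W = pt_open L a)"

text \<open>
  HOL cannot quantify over all types of frames inside a formula, so the frame is taken over the
  type \<^typ>\<open>'a set\<close>, which contains the frame of open sets of \<^term>\<open>Y\<close>. This loses nothing:
  see \<open>sober_spaceI\<close> below, where the frame has an arbitrary type.
\<close>

definition sober_space :: "'a topology \<Rightarrow> bool" where
  "sober_space Y \<longleftrightarrow> (\<exists>L :: 'a set gorder. frame L \<and> Y homeomorphic_space pt L)"

subsection \<open>Sobriety\<close>

text \<open>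
  The type chosen in \<open>sober_space\<close> is immaterial (\<open>sober_spaceI\<close>), and \<open>sober_space\<close> agrees with
  the characterization by generic points (\<open>sober_space_iff_generic_point\<close>).
\<close>

lemma two:
  shows frame_two: "frame two"
    and two_sup: "\<Squnion>\<^bsub>two\<^esub>A \<longleftrightarrow> (\<exists>x\<in>A. x)"
    and two_meet: "x \<sqinter>\<^bsub>two\<^esub> y \<longleftrightarrow> x \<and> y"
    and two_top: "\<top>\<^bsub>two\<^esub>"
    and carrier_two: "carrier two = UNIV"
proof -
  show c: "carrier two = UNIV" by (simp add: two_def)
  interpret partial_order two
    by unfold_locales (auto simp: two_def)
  have l: "least two (\<exists>x\<in>A. x) (Upper two A)" for A
    by (auto simp: least_def Upper_def two_def)
  have g: "greatest two (\<forall>x\<in>A. x) (Lower two A)" for A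
    by (auto simp: greatest_def Lower_def two_def)
  interpret complete_lattice two
    by unfold_locales (use l g in blast)+
  have s: "\<Squnion>\<^bsub>two\<^esub>A \<longleftrightarrow> (\<exists>x\<in>A. x)" for A
    by (rule least_unique[OF sup_lub l]) (simp add: c)
  have i: "\<Sqinter>\<^bsub>two\<^esub>A \<longleftrightarrow> (\<forall>x\<in>A. x)" for A
    by (rule greatest_unique[OF inf_glb g]) (simp add: c)
  show "\<Squnion>\<^bsub>two\<^esub>A \<longleftrightarrow> (\<exists>x\<in>A. x)" by (rule s)
  show m: "x \<sqinter>\<^bsub>two\<^esub> y \<longleftrightarrow> x \<and> y" for x y by (simp add: meet_def i)
  show "\<top>\<^bsub>two\<^esub>" using top_higher[of True] by (simp add: two_def)
  show "frame two" by unfold_locales (simp add: s m)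
qed

lemmas two_simps = two_sup two_meet two_top carrier_two

lemma points_iff:
  "p \<in> points L \<longleftrightarrow> p \<in> extensional (carrier L) \<and> p \<top>\<^bsub>L\<^esub> \<and>
     (\<forall>a\<in>carrier L. \<forall>b\<in>carrier L. p (a \<sqinter>\<^bsub>L\<^esub> b) \<longleftrightarrow> p a \<and> p b) \<and>
     (\<forall>S\<subseteq>carrier L. p (\<Squnion>\<^bsub>L\<^esub>S) \<longleftrightarrow> (\<exists>s\<in>S. p s))"
  by (auto simp: points_def frame_hom_def two_simps)

lemma openin_pt:
  assumes "frame L"
  shows "openin (pt L) W \<longleftrightarrow> (\<exists>a\<in>carrier L. W = pt_open L a)"
proof -
  interpret frame L by fact
  have "istopology (\<lambda>W. \<exists>a\<in>carrier L. W = pt_open L a)"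
    unfolding istopology_def
  proof (intro conjI allI impI)
    fix S T assume "\<exists>a\<in>carrier L. S = pt_open L a" "\<exists>a\<in>carrier L. T = pt_open L a"
    then obtain a b where "a \<in> carrier L" "S = pt_open L a" "b \<in> carrier L" "T = pt_open L b"
      by blast
    then have "S \<inter> T = pt_open L (a \<sqinter>\<^bsub>L\<^esub> b)" "a \<sqinter>\<^bsub>L\<^esub> b \<in> carrier L"
      by (auto simp: pt_open_def points_iff)
    then show "\<exists>c\<in>carrier L. S \<inter> T = pt_open L c" by blast
  next
    fix K assume K: "\<forall>S\<in>K. \<exists>a\<in>carrier L. S = pt_open L a"
    define A where "A = {a \<in> carrier L. pt_open L a \<in> K}"
    have "\<Union>K = (\<Union>a\<in>A. pt_open L a)"
      using K unfolding A_def by auto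
    also have "\<dots> = pt_open L (\<Squnion>\<^bsub>L\<^esub>A)"
    proof -
      have "A \<subseteq> carrier L" by (auto simp: A_def)
      then show ?thesis by (auto simp: pt_open_def points_iff)
    qed
    finally have "\<Union>K = pt_open L (\<Squnion>\<^bsub>L\<^esub>A)" .
    moreover have "\<Squnion>\<^bsub>L\<^esub>A \<in> carrier L"
      by (rule sup_closed) (auto simp: A_def)
    ultimately show "\<exists>c\<in>carrier L. \<Union>K = pt_open L c" by blast
  qed
  then show ?thesis
    by (simp add: pt_def topology_inverse')
qed

lemma topspace_pt:
  assumes "frame L"
  shows "topspace (pt L) = points L"
proof -
  interpret frame L by fact
  have "pt_open L \<top>\<^bsub>L\<^esub> = points L"
    by (auto simp: pt_open_def points_iff)
  then have "openin (pt L) (points L)"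
    using openin_pt[OF assms] top_closed by metis
  moreover have "topspace (pt L) \<subseteq> points L"
    using openin_pt[OF assms, of "topspace (pt L)"] by (auto simp: pt_open_def)
  ultimately show ?thesis
    by (meson openin_subset subset_antisym)
qed

definition open_frame :: "'a topology \<Rightarrow> 'a set gorder" where
  "open_frame Y = \<lparr>carrier = {U. openin Y U}, eq = (=), le = (\<subseteq>)\<rparr>"

lemma open_frame:
  shows frame_open_frame: "frame (open_frame Y)"
    and open_frame_sup: "K \<subseteq> {U. openin Y U} \<Longrightarrow> \<Squnion>\<^bsub>open_frame Y\<^esub>K = \<Union>K"
    and open_frame_meet: "openin Y U \<Longrightarrow> openin Y V \<Longrightarrow> U \<sqinter>\<^bsub>open_frame Y\<^esub> V = U \<inter> V"
    and open_frame_top: "\<top>\<^bsub>open_frame Y\<^esub> = topspace Y"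
proof -
  let ?L = "open_frame Y"
  have c: "carrier ?L = {U. openin Y U}" by (simp add: open_frame_def)
  interpret partial_order ?L
    by unfold_locales (auto simp: open_frame_def)
  have l: "least ?L (\<Union>K) (Upper ?L K)" if "K \<subseteq> carrier ?L" for K
    using that by (auto simp: least_def Upper_def open_frame_def)
  have g: "greatest ?L (\<Union>{V. openin Y V \<and> (\<forall>U\<in>K. V \<subseteq> U)}) (Lower ?L K)" if "K \<subseteq> carrier ?L" for K
    using that unfolding greatest_def Lower_def open_frame_def
    by (auto intro!: openin_Union)
  interpret complete_lattice ?L
    by unfold_locales (use l g in blast)+
  have s: "\<Squnion>\<^bsub>?L\<^esub>K = \<Union>K" if "K \<subseteq> carrier ?L" for K
    by (rule least_unique[OF sup_lub[OF that] l[OF that]])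
  have m: "U \<sqinter>\<^bsub>?L\<^esub> V = U \<inter> V" if "openin Y U" "openin Y V" for U V
  proof -
    have "greatest ?L (U \<inter> V) (Lower ?L {U, V})"
      using that by (auto simp: greatest_def Lower_def open_frame_def)
    moreover have "{U, V} \<subseteq> carrier ?L" using that c by auto
    ultimately show ?thesis
      unfolding meet_def by (intro greatest_unique[OF inf_glb])
  qed
  show "K \<subseteq> {U. openin Y U} \<Longrightarrow> \<Squnion>\<^bsub>?L\<^esub>K = \<Union>K" using s c by simp
  show "openin Y U \<Longrightarrow> openin Y V \<Longrightarrow> U \<sqinter>\<^bsub>?L\<^esub> V = U \<inter> V" by (rule m)
  have "\<top>\<^bsub>?L\<^esub> \<in> carrier ?L" by simp
  then have "\<top>\<^bsub>?L\<^esub> \<subseteq> topspace Y" by (simp add: c openin_subset)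
  moreover have "topspace Y \<subseteq> \<top>\<^bsub>?L\<^esub>"
    using top_higher[of "topspace Y"] by (simp add: open_frame_def)
  ultimately show "\<top>\<^bsub>?L\<^esub> = topspace Y" by blast
  show "frame ?L"
  proof unfold_locales
    fix U K assume U: "U \<in> carrier ?L" and K: "K \<subseteq> carrier ?L"
    have "(\<lambda>V. U \<sqinter>\<^bsub>?L\<^esub> V) ` K = (\<lambda>V. U \<inter> V) ` K"
      using U K c m by (intro image_cong) auto
    moreover have "\<Squnion>\<^bsub>?L\<^esub>((\<lambda>V. U \<inter> V) ` K) = U \<inter> \<Union>K"
    proof -
      have "(\<lambda>V. U \<inter> V) ` K \<subseteq> carrier ?L" using U K c by auto
      from s[OF this] show ?thesis by blast
    qed
    moreover have "U \<sqinter>\<^bsub>?L\<^esub> \<Squnion>\<^bsub>?L\<^esub>K = U \<inter> \<Union>K"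
    proof -
      have "openin Y (\<Union>K)" using K c by auto
      then show ?thesis unfolding s[OF K] using U c by (intro m) auto
    qed
    ultimately show "U \<sqinter>\<^bsub>?L\<^esub> \<Squnion>\<^bsub>?L\<^esub>K = \<Squnion>\<^bsub>?L\<^esub>((\<lambda>V. U \<sqinter>\<^bsub>?L\<^esub> V) ` K)"
      by metis
  qed
qed

lemma carrier_open_frame: "carrier (open_frame Y) = {U. openin Y U}"
  by (simp add: open_frame_def)

lemma points_open_frame_iff:
  "q \<in> points (open_frame Y) \<longleftrightarrow> q \<in> extensional {U. openin Y U} \<and> q (topspace Y) \<and>
     (\<forall>U V. openin Y U \<longrightarrow> openin Y V \<longrightarrow> (q (U \<inter> V) \<longleftrightarrow> q U \<and> q V)) \<and>
     (\<forall>K\<subseteq>{U. openin Y U}. q (\<Union>K) \<longleftrightarrow> (\<exists>U\<in>K. q U))"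
  unfolding points_iff carrier_open_frame open_frame_top
  by (simp add: open_frame_sup open_frame_meet)

definition pt_of :: "'a topology \<Rightarrow> 'a \<Rightarrow> 'a set \<Rightarrow> bool" where
  "pt_of Y y = (\<lambda>U\<in>{U. openin Y U}. y \<in> U)"

lemma pt_of_in_points: "y \<in> topspace Y \<Longrightarrow> pt_of Y y \<in> points (open_frame Y)"
  by (auto simp: points_open_frame_iff pt_of_def)

lemma pt_of_bij_imp_sober_space:
  assumes "bij_betw (pt_of Y) (topspace Y) (points (open_frame Y))"
  shows "sober_space Y"
proof -
  have pre: "{y \<in> topspace Y. pt_of Y y \<in> pt_open (open_frame Y) U} = U" if "openin Y U" for U
    using that openin_subset[OF that] pt_of_in_points[of _ Y]
    by (auto simp: pt_open_def) (auto simp: pt_of_def)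
  have "homeomorphic_map Y (pt (open_frame Y)) (pt_of Y)"
  proof (rule bijective_open_imp_homeomorphic_map)
    show "continuous_map Y (pt (open_frame Y)) (pt_of Y)"
      unfolding continuous_map_def
    proof (intro conjI allI impI)
      show "pt_of Y \<in> topspace Y \<rightarrow> topspace (pt (open_frame Y))"
        using pt_of_in_points by (auto simp: topspace_pt[OF frame_open_frame])
      fix W assume "openin (pt (open_frame Y)) W"
      then obtain U where "openin Y U" "W = pt_open (open_frame Y) U"
        unfolding openin_pt[OF frame_open_frame] carrier_open_frame by blast
      then show "openin Y {y \<in> topspace Y. pt_of Y y \<in> W}"
        using pre by simp
    qed
    show "open_map Y (pt (open_frame Y)) (pt_of Y)"
      unfolding open_map_def
    proof (intro allI impI)
      fix U assume U: "openin Y U"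
      have "pt_of Y ` U = pt_open (open_frame Y) U"
      proof -
        have "pt_open (open_frame Y) U \<subseteq> pt_of Y ` topspace Y"
          using assms by (auto simp: bij_betw_def pt_open_def)
        then show ?thesis using pre[OF U] by blast
      qed
      then show "openin (pt (open_frame Y)) (pt_of Y ` U)"
        unfolding openin_pt[OF frame_open_frame] carrier_open_frame using U by blast
    qed
    show "pt_of Y ` topspace Y = topspace (pt (open_frame Y))" "inj_on (pt_of Y) (topspace Y)"
      using assms by (auto simp: bij_betw_def topspace_pt[OF frame_open_frame])
  qed
  then show ?thesis
    unfolding sober_space_def
    using frame_open_frame homeomorphic_map_imp_homeomorphic_space by blast
qed

lemma homeomorphic_pt_imp_pt_of_bij:
  fixes L :: "'l gorder"
  assumes "frame L" "Y homeomorphic_space pt L"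
  shows "bij_betw (pt_of Y) (topspace Y) (points (open_frame Y))"
proof -
  interpret frame L by fact
  obtain h where h: "homeomorphic_map Y (pt L) h"
    using assms(2) homeomorphic_space by blast
  have hpt: "h ` topspace Y = points L" and inj: "inj_on h (topspace Y)"
    using homeomorphic_imp_surjective_map[OF h] homeomorphic_imp_injective_map[OF h]
    by (simp_all add: topspace_pt[OF assms(1)])
  define O' where "O' a = {y \<in> topspace Y. h y a}" for a
  have O'_eq: "O' a = {y \<in> topspace Y. h y \<in> pt_open L a}" for a
    using hpt by (auto simp: O'_def pt_open_def)
  have open_O': "openin Y (O' a)" if "a \<in> carrier L" for a
    unfolding O'_eq
    by (rule openin_continuous_map_preimage[OF homeomorphic_imp_continuous_map[OF h]])
       (use that assms(1) openin_pt in blast)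
  have ex_O': "\<exists>a\<in>carrier L. U = O' a" if "openin Y U" for U
  proof -
    have "openin (pt L) (h ` U)"
      using h that homeomorphic_imp_open_map open_map_def by blast
    then obtain a where a: "a \<in> carrier L" "h ` U = pt_open L a"
      using assms(1) openin_pt by blast
    have "U = O' a"
      unfolding O'_eq a(2)[symmetric] using inj openin_subset[OF that] by (auto dest: inj_onD)
    with a show ?thesis by blast
  qed
  have hy: "h y \<in> points L" if "y \<in> topspace Y" for y using hpt that by blast
  show ?thesis
    unfolding bij_betw_def
  proof (intro conjI inj_onI equalityI subsetI)
    fix y y' assume y: "y \<in> topspace Y" "y' \<in> topspace Y" and eq: "pt_of Y y = pt_of Y y'"
    have "h y a = h y' a" if "a \<in> carrier L" for a
      using fun_cong[OF eq, of "O' a"] open_O'[OF that] y by (auto simp: pt_of_def O'_def)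
    then have "h y = h y'"
      using hy y by (intro extensionalityI[of _ "carrier L"]) (auto simp: points_def)
    then show "y = y'" using inj y by (auto dest: inj_onD)
  next
    fix q assume "q \<in> pt_of Y ` topspace Y"
    then show "q \<in> points (open_frame Y)" by (auto intro: pt_of_in_points)
  next
    fix q assume q: "q \<in> points (open_frame Y)"
    have "(\<lambda>a\<in>carrier L. q (O' a)) \<in> points L"
    proof -
      have t: "O' \<top>\<^bsub>L\<^esub> = topspace Y" using hy by (auto simp: O'_def points_iff)
      have m: "O' (a \<sqinter>\<^bsub>L\<^esub> b) = O' a \<inter> O' b" if "a \<in> carrier L" "b \<in> carrier L" for a b
        using hy that by (auto simp: O'_def points_iff)
      have j: "O' (\<Squnion>\<^bsub>L\<^esub>S) = \<Union>(O' ` S)" if "S \<subseteq> carrier L" for S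
        using hy that by (auto simp: O'_def points_iff)
      have qj: "q (\<Union>(O' ` S)) \<longleftrightarrow> (\<exists>s\<in>S. q (O' s))" if "S \<subseteq> carrier L" for S
      proof -
        have "O' ` S \<subseteq> {U. openin Y U}" using open_O' that by auto
        then have "q (\<Union>(O' ` S)) \<longleftrightarrow> (\<exists>U\<in>O' ` S. q U)"
          using q unfolding points_open_frame_iff by blast
        then show ?thesis by simp
      qed
      have qm: "q (U \<inter> V) \<longleftrightarrow> q U \<and> q V" if "openin Y U" "openin Y V" for U V
        using q that unfolding points_open_frame_iff by blast
      show ?thesis
        unfolding points_iff
      proof (intro conjI ballI allI impI)
        show "(\<lambda>a\<in>carrier L. q (O' a)) \<top>\<^bsub>L\<^esub>"
          using q by (simp add: t points_open_frame_iff)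
        show "(\<lambda>a\<in>carrier L. q (O' a)) (a \<sqinter>\<^bsub>L\<^esub> b) \<longleftrightarrow>
            (\<lambda>a\<in>carrier L. q (O' a)) a \<and> (\<lambda>a\<in>carrier L. q (O' a)) b"
          if "a \<in> carrier L" "b \<in> carrier L" for a b
          using that by (simp add: m qm open_O')
        show "(\<lambda>a\<in>carrier L. q (O' a)) (\<Squnion>\<^bsub>L\<^esub>S) \<longleftrightarrow> (\<exists>a\<in>S. (\<lambda>a\<in>carrier L. q (O' a)) a)"
          if S: "S \<subseteq> carrier L" for S
        proof -
          have "(\<exists>a\<in>S. (\<lambda>a\<in>carrier L. q (O' a)) a) \<longleftrightarrow> (\<exists>a\<in>S. q (O' a))"
            using S by (intro bex_cong) auto
          then show ?thesis using sup_closed[OF S] by (simp only: restrict_apply' j[OF S] qj[OF S])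
        qed
      qed simp
    qed
    then obtain y where y: "y \<in> topspace Y" "h y = (\<lambda>a\<in>carrier L. q (O' a))"
      using hpt by (metis imageE)
    have "pt_of Y y U = q U" if "openin Y U" for U
    proof -
      obtain a where a: "a \<in> carrier L" "U = O' a" using ex_O' \<open>openin Y U\<close> by blast
      then have "y \<in> U \<longleftrightarrow> q U" using y by (simp add: O'_def[of a])
      then show ?thesis using that by (simp add: pt_of_def)
    qed
    then have "pt_of Y y = q"
      using q by (intro extensionalityI[of _ "{U. openin Y U}"])
        (auto simp: pt_of_def points_open_frame_iff)
    then show "q \<in> pt_of Y ` topspace Y" using y by blast
  qed
qed

lemma sober_spaceI:
  fixes L :: "'l gorder"
  assumes "frame L" "Y homeomorphic_space pt L"
  shows "sober_space Y"
  using assms homeomorphic_pt_imp_pt_of_bij pt_of_bij_imp_sober_space by blast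

lemma sober_space_iff_pt_of_bij:
  "sober_space Y \<longleftrightarrow> bij_betw (pt_of Y) (topspace Y) (points (open_frame Y))"
  using homeomorphic_pt_imp_pt_of_bij pt_of_bij_imp_sober_space sober_space_def by metis

no_notation eq_closure_of (\<open>closure'_of\<index>\<close>)

definition irreducible_closedin :: "'a topology \<Rightarrow> 'a set \<Rightarrow> bool" where
  "irreducible_closedin Y C \<longleftrightarrow> closedin Y C \<and> C \<noteq> {} \<and>
     (\<forall>C1 C2. closedin Y C1 \<and> closedin Y C2 \<and> C = C1 \<union> C2 \<longrightarrow> C = C1 \<or> C = C2)"

lemma pt_of_eq_iff:
  assumes "x \<in> topspace Y" "y \<in> topspace Y"
  shows "pt_of Y x = pt_of Y y \<longleftrightarrow> Y closure_of {x} = Y closure_of {y}"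
proof
  assume "pt_of Y x = pt_of Y y"
  then have "x \<in> U \<longleftrightarrow> y \<in> U" if "openin Y U" for U
    using that by (metis mem_Collect_eq pt_of_def restrict_apply')
  then show "Y closure_of {x} = Y closure_of {y}"
    by (auto simp: closure_of_def)
next
  assume eq: "Y closure_of {x} = Y closure_of {y}"
  have "x \<in> Y closure_of {x}" "y \<in> Y closure_of {y}"
    using assms by (auto simp: closure_of_def)
  then have "x \<in> U \<longleftrightarrow> y \<in> U" if "openin Y U" for U
    using that eq by (auto simp: closure_of_def)
  then show "pt_of Y x = pt_of Y y"
    by (auto simp: pt_of_def fun_eq_iff restrict_def)
qed

lemma sober_space_iff_generic_point:
  "sober_space Y \<longleftrightarrow>
     (\<forall>C. irreducible_closedin Y C \<longrightarrow> (\<exists>!x. x \<in> topspace Y \<and> Y closure_of {x} = C))"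
  (is "_ \<longleftrightarrow> ?R")
proof
  assume "sober_space Y"
  then have inj: "inj_on (pt_of Y) (topspace Y)" and
    sur: "pt_of Y ` topspace Y = points (open_frame Y)"
    by (auto simp: sober_space_iff_pt_of_bij bij_betw_def)
  show ?R
  proof (intro allI impI)
    fix C assume C: "irreducible_closedin Y C"
    define q where "q = (\<lambda>U\<in>{U. openin Y U}. U \<inter> C \<noteq> {})"
    have CY: "C \<subseteq> topspace Y" "C \<noteq> {}" and cC: "closedin Y C"
      using C closedin_subset by (auto simp: irreducible_closedin_def)
    have *: "U \<inter> V \<inter> C \<noteq> {}" if "openin Y U" "openin Y V" "U \<inter> C \<noteq> {}" "V \<inter> C \<noteq> {}" for U V
    proof
      assume "U \<inter> V \<inter> C = {}"
      then have "C = (C - U) \<union> (C - V)" by blast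
      moreover have "closedin Y (C - U)" "closedin Y (C - V)"
        using cC that by (auto intro: closedin_diff)
      ultimately have "C = C - U \<or> C = C - V"
        using C unfolding irreducible_closedin_def by blast
      then show False using that by blast
    qed
    have "q \<in> points (open_frame Y)"
      unfolding points_open_frame_iff
    proof (intro conjI allI impI)
      show "q \<in> extensional {U. openin Y U}" by (simp add: q_def)
      show "q (topspace Y)" using CY by (auto simp: q_def)
      show "q (U \<inter> V) \<longleftrightarrow> q U \<and> q V" if "openin Y U" "openin Y V" for U V
        using that *[OF that] by (auto simp: q_def)
      show "q (\<Union>K) \<longleftrightarrow> (\<exists>U\<in>K. q U)" if "K \<subseteq> {U. openin Y U}" for K
      proof -
        have "openin Y (\<Union>K)" using that by auto
        then have "q (\<Union>K) \<longleftrightarrow> \<Union>K \<inter> C \<noteq> {}" by (simp add: q_def)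
        moreover have "(\<exists>U\<in>K. q U) \<longleftrightarrow> (\<exists>U\<in>K. U \<inter> C \<noteq> {})"
          using that by (intro bex_cong) (auto simp: q_def)
        ultimately show ?thesis by blast
      qed
    qed
    then obtain x where x: "x \<in> topspace Y" "pt_of Y x = q" using sur by (metis imageE)
    have xU: "x \<in> U \<longleftrightarrow> U \<inter> C \<noteq> {}" if "openin Y U" for U
      using fun_cong[OF x(2), of U] that by (simp add: pt_of_def q_def)
    have "x \<in> C"
      using xU[of "topspace Y - C"] cC x(1) by (auto simp: closedin_def)
    have "Y closure_of {x} = C"
    proof
      show "Y closure_of {x} \<subseteq> C" using \<open>x \<in> C\<close> cC by (simp add: closure_of_minimal)
      show "C \<subseteq> Y closure_of {x}" using xU CY by (auto simp: closure_of_def)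
    qed
    then show "\<exists>!x. x \<in> topspace Y \<and> Y closure_of {x} = C"
      using x(1) pt_of_eq_iff inj by (metis inj_onD)
  qed
next
  assume R: ?R
  have irr: "irreducible_closedin Y (Y closure_of {x})" if x: "x \<in> topspace Y" for x
    unfolding irreducible_closedin_def
  proof (intro conjI allI impI)
    have xin: "x \<in> Y closure_of {x}" using x by (auto simp: closure_of_def)
    then show "Y closure_of {x} \<noteq> {}" by blast
    fix C1 C2 assume c: "closedin Y C1 \<and> closedin Y C2 \<and> Y closure_of {x} = C1 \<union> C2"
    then have "x \<in> C1 \<or> x \<in> C2" using xin by blast
    then show "Y closure_of {x} = C1 \<or> Y closure_of {x} = C2"
      using c closure_of_minimal[of "{x}" _ Y] by blast
  qed simp
  show "sober_space Y"
    unfolding sober_space_iff_pt_of_bij bij_betw_def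
  proof (intro conjI inj_onI equalityI subsetI)
    fix x y assume "x \<in> topspace Y" "y \<in> topspace Y" "pt_of Y x = pt_of Y y"
    then show "x = y" using R irr pt_of_eq_iff by metis
  next
    fix q assume "q \<in> pt_of Y ` topspace Y"
    then show "q \<in> points (open_frame Y)" by (auto intro: pt_of_in_points)
  next
    fix q assume q: "q \<in> points (open_frame Y)"
    have qU: "q (U \<inter> V) \<longleftrightarrow> q U \<and> q V" if "openin Y U" "openin Y V" for U V
      using q that by (simp add: points_open_frame_iff)
    define V where "V = \<Union>{U. openin Y U \<and> \<not> q U}"
    have oV: "openin Y V" unfolding V_def by auto
    have "\<forall>K\<subseteq>{U. openin Y U}. q (\<Union>K) \<longleftrightarrow> (\<exists>U\<in>K. q U)"
      using q by (simp add: points_open_frame_iff)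
    then have "q V \<longleftrightarrow> (\<exists>U\<in>{U. openin Y U \<and> \<not> q U}. q U)"
      unfolding V_def by (rule allE[of _ "{U. openin Y U \<and> \<not> q U}"]) auto
    then have nV: "\<not> q V" by blast
    have mono: "q W" if "q U" "U \<subseteq> W" "openin Y U" "openin Y W" for U W
      using qU[of U W] that by (simp add: Int_absorb2)
    have iff: "q U \<longleftrightarrow> \<not> U \<subseteq> V" if "openin Y U" for U
      using mono[of U V] that oV nV unfolding V_def by blast
    have qt: "q (topspace Y)" using q by (simp add: points_open_frame_iff)
    have "irreducible_closedin Y (topspace Y - V)"
      unfolding irreducible_closedin_def
    proof (intro conjI allI impI)
      show "closedin Y (topspace Y - V)" using oV by blast
      show "topspace Y - V \<noteq> {}" using qt iff[of "topspace Y"] by auto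
      fix C1 C2 assume c: "closedin Y C1 \<and> closedin Y C2 \<and> topspace Y - V = C1 \<union> C2"
      then have o: "openin Y (topspace Y - C1)" "openin Y (topspace Y - C2)" by auto
      have "(topspace Y - C1) \<inter> (topspace Y - C2) \<subseteq> V" using c by blast
      then have "\<not> q (topspace Y - C1) \<or> \<not> q (topspace Y - C2)"
        using qU[OF o] iff o by (metis openin_Int)
      then have "topspace Y - C1 \<subseteq> V \<or> topspace Y - C2 \<subseteq> V" using iff o by blast
      then show "topspace Y - V = C1 \<or> topspace Y - V = C2"
        using c by blast
    qed
    then obtain x where x: "x \<in> topspace Y" "Y closure_of {x} = topspace Y - V"
      using R by blast
    have "x \<in> U \<longleftrightarrow> q U" if U: "openin Y U" for U
    proof -
      have "x \<in> U \<longleftrightarrow> U \<inter> Y closure_of {x} \<noteq> {}"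
        using U x(1) by (auto simp: closure_of_def)
      also have "\<dots> \<longleftrightarrow> \<not> U \<subseteq> V"
        using x(2) openin_subset[OF U] by blast
      finally show ?thesis using iff[OF U] by simp
    qed
    then have "pt_of Y x = q"
      using q by (intro extensionalityI[of _ "{U. openin Y U}"])
        (auto simp: pt_of_def points_open_frame_iff)
    then show "q \<in> pt_of Y ` topspace Y" using x(1) by blast
  qed
qed


section \<open>The front topology\<close>

definition locally_closedin :: "'a topology \<Rightarrow> 'a set \<Rightarrow> bool" where
  "locally_closedin Y S \<longleftrightarrow> (\<exists>U C. openin Y U \<and> closedin Y C \<and> S = U \<inter> C)"

definition front :: "'a topology \<Rightarrow> 'a topology" where
  "front Y = topology_generated_by {S. locally_closedin Y S}"


section \<open>Sheaves of sets\<close>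

text \<open>
  The sets of sections over the various open sets all live in one type \<^typ>\<open>'s\<close>, but they need
  not be disjoint; \<open>res F U V\<close> restricts sections from \<^term>\<open>U\<close> to \<^term>\<open>V\<close>. The values of
  \<open>sections\<close> and \<open>res\<close> outside the open sets (and outside the sections) are irrelevant.
\<close>

record ('a, 's) presheaf =
  sections :: "'a set \<Rightarrow> 's set"
  res :: "'a set \<Rightarrow> 'a set \<Rightarrow> 's \<Rightarrow> 's"

definition is_presheaf :: "'a topology \<Rightarrow> ('a, 's) presheaf \<Rightarrow> bool" where
  "is_presheaf X F \<longleftrightarrow>
     (\<forall>U V. openin X U \<and> openin X V \<and> V \<subseteq> U \<longrightarrow> res F U V \<in> sections F U \<rightarrow> sections F V) \<and>
     (\<forall>U. openin X U \<longrightarrow> (\<forall>s\<in>sections F U. res F U U s = s)) \<and>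
     (\<forall>U V W. openin X U \<and> openin X V \<and> openin X W \<and> W \<subseteq> V \<and> V \<subseteq> U \<longrightarrow>
        (\<forall>s\<in>sections F U. res F V W (res F U V s) = res F U W s))"

definition is_sheaf :: "'a topology \<Rightarrow> ('a, 's) presheaf \<Rightarrow> bool" where
  "is_sheaf X F \<longleftrightarrow> is_presheaf X F \<and>
     (\<forall>\<U> \<sigma>. (\<forall>U\<in>\<U>. openin X U \<and> \<sigma> U \<in> sections F U) \<and>
            (\<forall>U\<in>\<U>. \<forall>V\<in>\<U>. res F U (U \<inter> V) (\<sigma> U) = res F V (U \<inter> V) (\<sigma> V)) \<longrightarrow>
            (\<exists>!s. s \<in> sections F (\<Union>\<U>) \<and> (\<forall>U\<in>\<U>. res F (\<Union>\<U>) U s = \<sigma> U)))"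

definition sheaf_hom ::
    "'a topology \<Rightarrow> ('a, 's) presheaf \<Rightarrow> ('a, 't) presheaf \<Rightarrow> ('a set \<Rightarrow> 's \<Rightarrow> 't) \<Rightarrow> bool" where
  "sheaf_hom X F G \<phi> \<longleftrightarrow>
     (\<forall>U. openin X U \<longrightarrow> \<phi> U \<in> sections F U \<rightarrow> sections G U) \<and>
     (\<forall>U V. openin X U \<and> openin X V \<and> V \<subseteq> U \<longrightarrow>
        (\<forall>s\<in>sections F U. \<phi> V (res F U V s) = res G U V (\<phi> U s)))"

definition preim :: "'a topology \<Rightarrow> ('a \<Rightarrow> 'b) \<Rightarrow> 'b set \<Rightarrow> 'a set" where
  "preim Y f W = {y \<in> topspace Y. f y \<in> W}"

definition pushforward ::
    "'a topology \<Rightarrow> ('a \<Rightarrow> 'b) \<Rightarrow> ('a, 's) presheaf \<Rightarrow> ('b, 's) presheaf" where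
  "pushforward Y f E =
     \<lparr>sections = (\<lambda>W. sections E (preim Y f W)),
      res = (\<lambda>W W'. res E (preim Y f W) (preim Y f W'))\<rparr>"


section \<open>The category of sheaves for the front topology\<close>

type_synonym ('a, 's) sh_obj = "'a topology \<times> ('a, 's) presheaf"
type_synonym ('a, 's, 'b, 't) sh_mor = "('a \<Rightarrow> 'b) \<times> ('b set \<Rightarrow> 't \<Rightarrow> 's)"

fun Sh_object :: "('a, 's) sh_obj \<Rightarrow> bool" where
  "Sh_object (Y, E) \<longleftrightarrow> is_sheaf (front Y) E \<and> sections E (topspace (front Y)) \<noteq> {}"

fun Sh_morphism ::
    "('a, 's) sh_obj \<Rightarrow> ('b, 't) sh_obj \<Rightarrow> ('a, 's, 'b, 't) sh_mor \<Rightarrow> bool" where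
  "Sh_morphism (Y, E) (Y', E') (f, l) \<longleftrightarrow>
     Sh_object (Y, E) \<and> Sh_object (Y', E') \<and>
     continuous_map Y Y' f \<and> sheaf_hom (front Y') E' (pushforward Y f E) l"

text \<open>
  Morphisms are only meaningful on their domains (points of the source space, sections over
  front-open sets of the target space), so equality of morphisms is equality there.
\<close>

fun Sh_eq ::
    "('a, 's) sh_obj \<Rightarrow> ('b, 't) sh_obj \<Rightarrow> ('a, 's, 'b, 't) sh_mor \<Rightarrow> ('a, 's, 'b, 't) sh_mor \<Rightarrow> bool"
  where
  "Sh_eq (Y, E) (Y', E') (f, l) (g, m) \<longleftrightarrow>
     (\<forall>y\<in>topspace Y. f y = g y) \<and>
     (\<forall>W. openin (front Y') W \<longrightarrow> (\<forall>t\<in>sections E' W. l W t = m W t))"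

definition Sh_id :: "('a, 's, 'a, 's) sh_mor" where
  "Sh_id = (id, \<lambda>U s. s)"

text \<open>
  The composite of \<open>(f, l) : (Y, E) \<rightarrow> (Y', E')\<close> and \<open>(g, m) : (Y', E') \<rightarrow> (Y'', E'')\<close>; the space
  \<open>Y'\<close> is needed for taking preimages along \<open>g\<close>.
\<close>

fun Sh_comp ::
    "'b topology \<Rightarrow> ('b, 't, 'c, 'u) sh_mor \<Rightarrow> ('a, 's, 'b, 't) sh_mor \<Rightarrow> ('a, 's, 'c, 'u) sh_mor"
  where
  "Sh_comp Y' (g, m) (f, l) = (g \<circ> f, \<lambda>W u. l (preim Y' g W) (m W u))"

definition Sh_iso ::
    "('a, 's) sh_obj \<Rightarrow> ('b, 't) sh_obj \<Rightarrow> ('a, 's, 'b, 't) sh_mor \<Rightarrow> bool" where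
  "Sh_iso X X' \<Phi> \<longleftrightarrow> Sh_morphism X X' \<Phi> \<and>
     (\<exists>\<Psi>. Sh_morphism X' X \<Psi> \<and>
          Sh_eq X X (Sh_comp (fst X') \<Psi> \<Phi>) Sh_id \<and>
          Sh_eq X' X' (Sh_comp (fst X) \<Phi> \<Psi>) Sh_id)"


section \<open>Skew lattices and the relation D\<close>

record 'c skew_lattice = "'c partial_object" +
  nmeet :: "'c \<Rightarrow> 'c \<Rightarrow> 'c" (infixl \<open>\<curlywedge>\<index>\<close> 70)
  njoin :: "'c \<Rightarrow> 'c \<Rightarrow> 'c" (infixl \<open>\<curlyvee>\<index>\<close> 65)

definition greenD :: "'c skew_lattice \<Rightarrow> ('c \<times> 'c) set" where
  "greenD A = {(a, b). a \<in> carrier A \<and> b \<in> carrier A \<and>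
     a \<curlywedge>\<^bsub>A\<^esub> b \<curlywedge>\<^bsub>A\<^esub> a = a \<and> b \<curlywedge>\<^bsub>A\<^esub> a \<curlywedge>\<^bsub>A\<^esub> b = b}"

definition Dclass :: "'c skew_lattice \<Rightarrow> 'c \<Rightarrow> 'c set" where
  "Dclass A a = greenD A `` {a}"

text \<open>The order of the quotient lattice: \<open>[a] \<le> [b]\<close> iff \<open>[a \<and> b] = [a]\<close>.\<close>

definition Dquot :: "'c skew_lattice \<Rightarrow> 'c set gorder" where
  "Dquot A = \<lparr>carrier = carrier A // greenD A, eq = (=),
     le = (\<lambda>C C'. \<exists>a\<in>C. \<exists>b\<in>C'. a \<curlywedge>\<^bsub>A\<^esub> b \<in> C)\<rparr>"


section \<open>The skew lattice of a sheaf\<close>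

fun H :: "('a, 's) sh_obj \<Rightarrow> ('a set \<times> 's) skew_lattice" where
  "H (Y, E) =
     \<lparr>carrier = {(U, s). openin Y U \<and> s \<in> sections E U},
      nmeet = (\<lambda>(U, s) (V, t). (U \<inter> V, res E U (U \<inter> V) s)),
      njoin = (\<lambda>(U, s) (V, t). (U \<union> V,
        THE r. r \<in> sections E (U \<union> V) \<and>
               res E (U \<union> V) (U - V) r = res E U (U - V) s \<and>
               res E (U \<union> V) V r = t))\<rparr>"


section \<open>The sheaf of a skew lattice\<close>

definition Uset :: "'c skew_lattice \<Rightarrow> 'c \<Rightarrow> ('c set \<Rightarrow> bool) set" where
  "Uset A a = pt_open (Dquot A) (Dclass A a)"

definition Yspace :: "'c skew_lattice \<Rightarrow> ('c set \<Rightarrow> bool) topology" where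
  "Yspace A = pt (Dquot A)"

definition germ_eq :: "'c skew_lattice \<Rightarrow> ('c set \<Rightarrow> bool) \<Rightarrow> 'c \<Rightarrow> 'c \<Rightarrow> bool" where
  "germ_eq A p a b \<longleftrightarrow>
     (\<exists>c\<in>carrier A. \<exists>d\<in>carrier A. \<not> p (Dclass A c) \<and> p (Dclass A d) \<and>
        (a \<curlywedge>\<^bsub>A\<^esub> d) \<curlyvee>\<^bsub>A\<^esub> c = (b \<curlywedge>\<^bsub>A\<^esub> d) \<curlyvee>\<^bsub>A\<^esub> c)"

definition germ :: "'c skew_lattice \<Rightarrow> ('c set \<Rightarrow> bool) \<Rightarrow> 'c \<Rightarrow> 'c set" where
  "germ A p a = {b \<in> carrier A. p (Dclass A b) \<and> germ_eq A p a b}"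

definition gsec :: "'c skew_lattice \<Rightarrow> 'c \<Rightarrow> ('c set \<Rightarrow> bool) \<Rightarrow> ('c set \<Rightarrow> bool) \<times> 'c set" where
  "gsec A a = (\<lambda>p\<in>Uset A a. (p, germ A p a))"

text \<open>The underlying set of this space is the union of the images of the sections \<open>gsec A a\<close>, that
  is, the set of all pairs \<open>(p, germ A p a)\<close> with \<open>p \<in> Uset A a\<close>.\<close>

definition Espace :: "'c skew_lattice \<Rightarrow> (('c set \<Rightarrow> bool) \<times> 'c set) topology" where
  "Espace A = topology_generated_by
     {gsec A a ` Z | a Z. a \<in> carrier A \<and> Z \<subseteq> Uset A a \<and> locally_closedin (Yspace A) Z}"

definition Esheaf :: "'c skew_lattice \<Rightarrow> ('c set \<Rightarrow> bool, ('c set \<Rightarrow> bool) \<Rightarrow> ('c set \<Rightarrow> bool) \<times> 'c set) presheaf"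
  where
  "Esheaf A =
     \<lparr>sections = (\<lambda>W. {\<sigma> \<in> extensional W.
        continuous_map (subtopology (front (Yspace A)) W) (Espace A) \<sigma> \<and> (\<forall>p\<in>W. fst (\<sigma> p) = p)}),
      res = (\<lambda>W W' \<sigma>. restrict \<sigma> W')\<rparr>"

definition G :: "'c skew_lattice \<Rightarrow> ('c set \<Rightarrow> bool, ('c set \<Rightarrow> bool) \<Rightarrow> ('c set \<Rightarrow> bool) \<times> 'c set) sh_obj"
  where
  "G A = (Yspace A, Esheaf A)"


section \<open>The natural morphism and sober sheaves\<close>

text \<open>
  The point of \<open>H (Y, E) / D\<close> given by \<open>y\<close>; the D-class of \<open>(U, s)\<close> is determined by \<open>U\<close>, and it is
  sent to the truth value of \<open>y \<in> U\<close>.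
\<close>

definition natural_map :: "('a, 's) sh_obj \<Rightarrow> 'a \<Rightarrow> ('a set \<times> 's) set \<Rightarrow> bool" where
  "natural_map X y = (\<lambda>C\<in>carrier (Dquot (H X)). \<exists>(U, s)\<in>C. y \<in> U)"

text \<open>
  The sheaf morphism that sends \<open>gsec (H (Y, E)) (U, s)\<close> to \<open>s\<close>. On an arbitrary section \<open>\<sigma>\<close> over
  \<open>W\<close>, which agrees locally with sections of this form, it is obtained by gluing: wherever
  \<open>\<sigma>\<close> agrees with \<open>gsec (H (Y, E)) (U, s)\<close>, its image agrees with \<open>s\<close>.
\<close>

fun natural_sheaf_hom ::
    "('a, 's) sh_obj \<Rightarrow> (('a set \<times> 's) set \<Rightarrow> bool) set \<Rightarrow>
     ((('a set \<times> 's) set \<Rightarrow> bool) \<Rightarrow> (('a set \<times> 's) set \<Rightarrow> bool) \<times> ('a set \<times> 's) set) \<Rightarrow> 's" where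
  "natural_sheaf_hom (Y, E) W \<sigma> =
     (let A = H (Y, E); pre = preim Y (natural_map (Y, E)) in
      THE t. t \<in> sections E (pre W) \<and>
        (\<forall>(U, s)\<in>carrier A. \<forall>Z.
           openin (front (Yspace A)) Z \<and> Z \<subseteq> W \<inter> Uset A (U, s) \<and>
           (\<forall>p\<in>Z. \<sigma> p = gsec A (U, s) p) \<longrightarrow>
           res E (pre W) (pre Z) t = res E U (pre Z) s))"

definition sober_sheaf :: "('a, 's) sh_obj \<Rightarrow> bool" where
  "sober_sheaf X \<longleftrightarrow> Sh_iso X (G (H X)) (natural_map X, natural_sheaf_hom X)"

end

theory Submission
  imports Defs "HOL-Analysis.Abstract_Topology_2"
begin

text \<open>
  Write \<open>A\<close> for the skew lattice \<open>H (Y, E)\<close>. Since \<open>E\<close> has a global section, every open set of \<open>Y\<close>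
  carries sections, and the D-class of \<open>(U, s)\<close> remembers exactly \<open>U\<close>. Hence \<open>A / D\<close> is the frame of
  open sets of \<open>Y\<close> and the natural map \<open>f\<close> is, up to this identification, the map \<open>pt_of Y\<close> from \<open>Y\<close>
  to the points of its frame of open sets (\<open>frame_Dquot\<close>, \<open>f_open_class\<close>).

  If the natural morphism is an isomorphism, then \<open>f\<close> is a homeomorphism from \<open>Y\<close> to the space of
  points of the frame \<open>A / D\<close>, so \<open>Y\<close> is sober.

  Conversely, let \<open>Y\<close> be sober. Then \<open>f\<close> is a homeomorphism, also for the front topologies, and what
  remains is that the sheaf component is bijective over each front-open set. This rests on two facts
  about a point \<open>y\<close> and its image \<open>f y\<close>.

  \<^item> The relation \<open>\<sim>\<close> at \<open>f y\<close> is equality of germs of \<open>E\<close> at \<open>y\<close> for the front topology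
    (\<open>germ_eq_iff\<close>): the equation \<open>(a \<and> d) \<or> c = (b \<and> d) \<or> c\<close>, with \<open>c\<close> over \<open>C\<close> and \<open>d\<close> over \<open>D\<close>, says
    that \<open>a\<close> and \<open>b\<close> agree on \<open>D - C\<close>, and the locally closed sets of this form are a neighbourhood
    basis of \<open>y\<close>.

  \<^item> Every germ of \<open>E\<close> at \<open>y\<close> is the germ of a section over an open set of \<open>Y\<close> (\<open>extend_germ\<close>): in the
    front topology a closed subset of an open set \<open>U\<close> is complemented in \<open>U\<close>, so a section over it
    extends to \<open>U\<close> by gluing it with a restriction of the global section.

  So the germs of the sheaf of \<open>A\<close> at \<open>f y\<close> are those of \<open>E\<close> at \<open>y\<close>, and a section of either sheaf is a
  continuous choice of germs.
\<close>


section \<open>The front topology\<close>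

lemma locally_closedin_Int:
  assumes "locally_closedin Y S" "locally_closedin Y T"
  shows "locally_closedin Y (S \<inter> T)"
proof -
  obtain U C V D where "openin Y U" "closedin Y C" "S = U \<inter> C" "openin Y V" "closedin Y D" "T = V \<inter> D"
    using assms by (auto simp: locally_closedin_def)
  then have "openin Y (U \<inter> V)" "closedin Y (C \<inter> D)" "S \<inter> T = (U \<inter> V) \<inter> (C \<inter> D)"
    by auto
  then show ?thesis unfolding locally_closedin_def by blast
qed

lemma locally_closedin_Diff:
  assumes "openin Y U" "openin Y V"
  shows "locally_closedin Y (U - V)"
proof -
  have "U - V = U \<inter> (topspace Y - V)" using openin_subset[OF assms(1)] by blast
  then show ?thesis using assms unfolding locally_closedin_def by blast
qed

lemma openin_imp_locally_closedin: "openin Y U \<Longrightarrow> locally_closedin Y U"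
  using locally_closedin_Diff[of Y U "{}"] by simp

text \<open>
  Locally closed sets are closed under intersection, so they form a basis and not only a subbasis.
\<close>

lemma openin_front_iff:
  "openin (front Y) N \<longleftrightarrow> (\<forall>y\<in>N. \<exists>S. locally_closedin Y S \<and> y \<in> S \<and> S \<subseteq> N)" (is "_ \<longleftrightarrow> ?R N")
proof
  assume "openin (front Y) N"
  then have "generate_topology_on {S. locally_closedin Y S} N"
    by (simp add: front_def openin_topology_generated_by_iff)
  then show "?R N"
  proof induction
    case (Int a b)
    show ?case
    proof
      fix y assume "y \<in> a \<inter> b"
      then obtain S T where "locally_closedin Y S" "y \<in> S" "S \<subseteq> a" "locally_closedin Y T" "y \<in> T" "T \<subseteq> b"
        using Int by blast
      then have "locally_closedin Y (S \<inter> T) \<and> y \<in> S \<inter> T \<and> S \<inter> T \<subseteq> a \<inter> b"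
        using locally_closedin_Int by blast
      then show "\<exists>S. locally_closedin Y S \<and> y \<in> S \<and> S \<subseteq> a \<inter> b" by blast
    qed
  next
    case (UN K)
    then show ?case by (meson Union_iff Sup_upper order_trans)
  qed auto
next
  assume R: "?R N"
  have "N = \<Union>{S. locally_closedin Y S \<and> S \<subseteq> N}" using R by blast
  moreover have "openin (front Y) (\<Union>{S. locally_closedin Y S \<and> S \<subseteq> N})"
    by (intro openin_Union) (auto simp: front_def intro: topology_generated_by_Basis)
  ultimately show "openin (front Y) N" by simp
qed

lemma front_neighbourhood:
  assumes "openin (front Y) N" "y \<in> N"
  obtains U C where "openin Y U" "closedin Y C" "y \<in> U \<inter> C" "U \<inter> C \<subseteq> N"
  using assms unfolding openin_front_iff locally_closedin_def by blast

lemma locally_closedin_imp_openin_front: "locally_closedin Y S \<Longrightarrow> openin (front Y) S"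
  by (auto simp: openin_front_iff)

lemma openin_imp_openin_front: "openin Y U \<Longrightarrow> openin (front Y) U"
  by (simp add: locally_closedin_imp_openin_front openin_imp_locally_closedin)

lemma openin_front_Diff: "openin Y U \<Longrightarrow> openin Y V \<Longrightarrow> openin (front Y) (U - V)"
  by (simp add: locally_closedin_imp_openin_front locally_closedin_Diff)

lemma topspace_front: "topspace (front Y) = topspace Y"
proof
  have "S \<subseteq> topspace Y" if "locally_closedin Y S" for S
    using that closedin_subset by (auto simp: locally_closedin_def)
  then show "topspace (front Y) \<subseteq> topspace Y"
    using openin_topspace[of "front Y"] unfolding openin_front_iff by blast
  show "topspace Y \<subseteq> topspace (front Y)"
    by (intro openin_subset openin_imp_openin_front) simp
qed

text \<open>
  Preimages of open and closed sets are open and closed, so preimages of locally closed sets are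
  locally closed.
\<close>

lemma continuous_map_front:
  assumes "continuous_map Y Y' f"
  shows "continuous_map (front Y) (front Y') f"
  unfolding continuous_map_def
proof (intro conjI allI impI)
  show "f \<in> topspace (front Y) \<rightarrow> topspace (front Y')"
    using assms by (simp add: topspace_front continuous_map_def)
  fix W assume W: "openin (front Y') W"
  show "openin (front Y) {y \<in> topspace (front Y). f y \<in> W}"
    unfolding openin_front_iff
  proof
    fix y assume y: "y \<in> {y \<in> topspace (front Y). f y \<in> W}"
    then obtain U C where UC: "openin Y' U" "closedin Y' C" "f y \<in> U \<inter> C" "U \<inter> C \<subseteq> W"
      using front_neighbourhood[OF W] by auto
    let ?S = "{y \<in> topspace Y. f y \<in> U} \<inter> {y \<in> topspace Y. f y \<in> C}"
    have "locally_closedin Y ?S"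
      unfolding locally_closedin_def
      using openin_continuous_map_preimage[OF assms UC(1)] closedin_continuous_map_preimage[OF assms UC(2)]
      by blast
    moreover have "y \<in> ?S" "?S \<subseteq> {y \<in> topspace (front Y). f y \<in> W}"
      using y UC by (auto simp: topspace_front)
    ultimately show "\<exists>S. locally_closedin Y S \<and> y \<in> S \<and> S \<subseteq> {y \<in> topspace (front Y). f y \<in> W}"
      by blast
  qed
qed

lemma openin_front_preim:
  assumes "continuous_map Y Y' f" "openin (front Y') W"
  shows "openin (front Y) (preim Y f W)"
  using openin_continuous_map_preimage[OF continuous_map_front[OF assms(1)] assms(2)]
  by (simp add: preim_def topspace_front)


section \<open>Isomorphisms of sheaves for the front topology\<close>

text \<open>
  The inverse has the inverse homeomorphism \<open>g\<close> as its first component. Its second component goes from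
  sections over \<open>U\<close> to sections over the preimage \<open>W\<close> of \<open>U\<close> under \<open>g\<close>; since the preimage of \<open>W\<close> under \<open>f\<close>
  is again \<open>U\<close>, it can be taken to be the inverse of \<open>l W\<close>, and its naturality follows from that of \<open>l\<close>.
\<close>

lemma Sh_isoI:
  assumes mor: "Sh_morphism (Y, E) (Y', E') (f, l)"
    and homeo: "homeomorphic_maps Y Y' f g"
    and bij: "\<And>W. openin (front Y') W \<Longrightarrow> bij_betw (l W) (sections E' W) (sections E (preim Y f W))"
  shows "Sh_iso (Y, E) (Y', E') (f, l)"
proof -
  have cont: "continuous_map Y Y' f" "continuous_map Y' Y g"
    and inv: "\<And>y. y \<in> topspace Y \<Longrightarrow> g (f y) = y" "\<And>y. y \<in> topspace Y' \<Longrightarrow> f (g y) = y"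
    using homeo by (auto simp: homeomorphic_maps_def)
  have obj: "Sh_object (Y, E)" "Sh_object (Y', E')" and hom: "sheaf_hom (front Y') E' (pushforward Y f E) l"
    using mor by auto
  have ff: "f y \<in> topspace Y'" if "y \<in> topspace Y" for y
    using cont(1) that by (auto simp: continuous_map_def)
  have gg: "g y \<in> topspace Y" if "y \<in> topspace Y'" for y
    using cont(2) that by (auto simp: continuous_map_def)
  have pfg: "preim Y f (preim Y' g U) = U" if "openin (front Y) U" for U
    using openin_subset[OF that] inv ff by (auto simp: preim_def topspace_front)
  have pgf: "preim Y' g (preim Y f W) = W" if "openin (front Y') W" for W
    using openin_subset[OF that] inv gg by (auto simp: preim_def topspace_front)
  define m where "m U = inv_into (sections E' (preim Y' g U)) (l (preim Y' g U))" for U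
  have og: "openin (front Y') (preim Y' g U)" if "openin (front Y) U" for U
    using openin_front_preim[OF cont(2) that] .
  have bijl: "bij_betw (l (preim Y' g U)) (sections E' (preim Y' g U)) (sections E U)"
    if "openin (front Y) U" for U
    using bij[OF og[OF that]] pfg[OF that] by simp
  have bijm: "bij_betw (m U) (sections E U) (sections E' (preim Y' g U))" if "openin (front Y) U" for U
    unfolding m_def using bijl[OF that] by (rule bij_betw_inv_into)
  have lm: "l (preim Y' g U) (m U s) = s" if "openin (front Y) U" "s \<in> sections E U" for U s
    unfolding m_def using bijl[OF that(1)] that(2) by (rule bij_betw_inv_into_right)
  have ml: "m (preim Y f W) (l W t) = t" if W: "openin (front Y') W" "t \<in> sections E' W" for W t
    unfolding m_def pgf[OF W(1)] using bij[OF W(1)] W(2) by (rule bij_betw_inv_into_left)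
  have pres: "res E' U V s \<in> sections E' V"
    if "openin (front Y') U" "openin (front Y') V" "V \<subseteq> U" "s \<in> sections E' U" for U V s
    using obj(2) that by (auto simp: is_sheaf_def is_presheaf_def)
  have homm: "sheaf_hom (front Y) E (pushforward Y' g E') m"
    unfolding sheaf_hom_def
  proof (intro conjI allI impI ballI)
    fix U assume "openin (front Y) U"
    then show "m U \<in> sections E U \<rightarrow> sections (pushforward Y' g E') U"
      using bijm by (auto simp: pushforward_def bij_betw_def)
  next
    fix U V s assume a: "openin (front Y) U \<and> openin (front Y) V \<and> V \<subseteq> U" and s: "s \<in> sections E U"
    let ?U = "preim Y' g U" and ?V = "preim Y' g V"
    have sub: "?V \<subseteq> ?U" using a by (auto simp: preim_def)
    have mU: "m U s \<in> sections E' ?U" using bijm a s by (auto simp: bij_betw_def)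
    have "l ?V (res E' ?U ?V (m U s)) = res E (preim Y f ?U) (preim Y f ?V) (l ?U (m U s))"
      using hom og a mU sub by (auto simp: sheaf_hom_def pushforward_def)
    also have "\<dots> = res E U V s" using a s lm pfg by simp
    finally have "res E' ?U ?V (m U s) = m V (res E U V s)"
      using ml[OF og pres[OF og og sub mU]] a pfg by simp
    then show "m V (res E U V s) = res (pushforward Y' g E') U V (m U s)"
      by (simp add: pushforward_def)
  qed
  have "Sh_morphism (Y', E') (Y, E) (g, m)"
    using obj cont homm by auto
  moreover have "Sh_eq (Y, E) (Y, E) (Sh_comp Y' (g, m) (f, l)) Sh_id"
    using inv lm by (auto simp: Sh_id_def)
  moreover have "Sh_eq (Y', E') (Y', E') (Sh_comp Y (f, l) (g, m)) Sh_id"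
    using inv ml by (auto simp: Sh_id_def)
  ultimately show ?thesis
    unfolding Sh_iso_def using mor by (metis fst_conv)
qed


section \<open>Germs and gluing in a sheaf\<close>

locale sheaf_on =
  fixes X :: "'a topology" and E :: "('a, 's) presheaf"
  assumes sheaf: "is_sheaf X E"
begin

lemma res_closed:
  "openin X U \<Longrightarrow> openin X V \<Longrightarrow> V \<subseteq> U \<Longrightarrow> s \<in> sections E U \<Longrightarrow> res E U V s \<in> sections E V"
  using sheaf by (auto simp: is_sheaf_def is_presheaf_def)

lemma res_self: "openin X U \<Longrightarrow> s \<in> sections E U \<Longrightarrow> res E U U s = s"
  using sheaf by (auto simp: is_sheaf_def is_presheaf_def)

lemma res_res:
  "openin X U \<Longrightarrow> openin X V \<Longrightarrow> openin X W \<Longrightarrow> W \<subseteq> V \<Longrightarrow> V \<subseteq> U \<Longrightarrow> s \<in> sections E U \<Longrightarrow>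
     res E V W (res E U V s) = res E U W s"
  using sheaf unfolding is_sheaf_def is_presheaf_def by blast

text \<open>
  The sheaf axiom for families with an arbitrary index type. A set that occurs for several indices
  carries only one section, because compatibility on a set with itself is equality.
\<close>

lemma glue:
  assumes op: "\<And>i. i \<in> I \<Longrightarrow> openin X (N i)" and sec: "\<And>i. i \<in> I \<Longrightarrow> \<sigma> i \<in> sections E (N i)"
    and compat: "\<And>i j. i \<in> I \<Longrightarrow> j \<in> I \<Longrightarrow>
      res E (N i) (N i \<inter> N j) (\<sigma> i) = res E (N j) (N i \<inter> N j) (\<sigma> j)"
  shows "\<exists>!s. s \<in> sections E (\<Union>(N ` I)) \<and> (\<forall>i\<in>I. res E (\<Union>(N ` I)) (N i) s = \<sigma> i)"
proof -
  define \<tau> where "\<tau> U = \<sigma> (SOME i. i \<in> I \<and> N i = U)" for U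
  have same: "\<sigma> i = \<sigma> j" if "i \<in> I" "j \<in> I" "N i = N j" for i j
    using compat[OF that(1,2)] that op sec res_self by (metis inf.idem)
  have \<tau>: "\<tau> (N i) = \<sigma> i" if "i \<in> I" for i
  proof -
    define j where "j = (SOME j. j \<in> I \<and> N j = N i)"
    have "j \<in> I \<and> N j = N i" unfolding j_def by (rule someI[of _ i]) (simp add: that)
    then show ?thesis using same[of j i] that by (simp add: \<tau>_def flip: j_def)
  qed
  have "\<exists>!s. s \<in> sections E (\<Union>(N ` I)) \<and> (\<forall>U\<in>N ` I. res E (\<Union>(N ` I)) U s = \<tau> U)"
  proof -
    have *: "\<forall>\<U> \<sigma>. (\<forall>U\<in>\<U>. openin X U \<and> \<sigma> U \<in> sections E U) \<and>
      (\<forall>U\<in>\<U>. \<forall>V\<in>\<U>. res E U (U \<inter> V) (\<sigma> U) = res E V (U \<inter> V) (\<sigma> V)) \<longrightarrow>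
      (\<exists>!s. s \<in> sections E (\<Union>\<U>) \<and> (\<forall>U\<in>\<U>. res E (\<Union>\<U>) U s = \<sigma> U))"
      using sheaf unfolding is_sheaf_def by (rule conjunct2)
    show ?thesis
      by (rule mp[OF spec[OF spec[OF *]]]) (auto simp: \<tau> op sec intro: compat)
  qed
  then show ?thesis using \<tau> by simp
qed

lemma section_eqI:
  assumes "\<And>i. i \<in> I \<Longrightarrow> openin X (N i)" "M = \<Union>(N ` I)" "s \<in> sections E M" "t \<in> sections E M"
    and "\<And>i. i \<in> I \<Longrightarrow> res E M (N i) s = res E M (N i) t"
  shows "s = t"
proof -
  have oM: "openin X M" using assms(1,2) by auto
  have sub: "N i \<subseteq> M" if "i \<in> I" for i using that assms(2) by auto
  have "\<exists>!r. r \<in> sections E (\<Union>(N ` I)) \<and> (\<forall>i\<in>I. res E (\<Union>(N ` I)) (N i) r = res E M (N i) s)"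
  proof (rule glue)
    fix i j assume ij: "i \<in> I" "j \<in> I"
    show "res E (N i) (N i \<inter> N j) (res E M (N i) s) = res E (N j) (N i \<inter> N j) (res E M (N j) s)"
      using ij assms(1)[OF ij(1)] assms(1)[OF ij(2)] oM sub[OF ij(1)] sub[OF ij(2)] assms(3)
      by (simp add: res_res openin_Int)
  qed (use assms oM sub res_closed in auto)
  then show ?thesis using assms(2-5) by metis
qed

text \<open>
  On the empty intersection the two sections agree because the sheaf axiom for the empty cover leaves
  only one section over the empty set.
\<close>

lemma glue_disjoint:
  assumes "openin X M" "openin X N" "M \<inter> N = {}" "s \<in> sections E M" "t \<in> sections E N"
  shows "\<exists>!r. r \<in> sections E (M \<union> N) \<and> res E (M \<union> N) M r = s \<and> res E (M \<union> N) N r = t"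
proof -
  have empty: "u = v" if "u \<in> sections E {}" "v \<in> sections E {}" for u v
    using section_eqI[of "{}" "\<lambda>_::unit. {}" "{}" u v] that by auto
  have "res E M {} s = res E N {} t"
    using assms by (intro empty res_closed) auto
  moreover have "N \<inter> M = {}" using assms(3) by blast
  ultimately have "\<exists>!r. r \<in> sections E (\<Union>((\<lambda>b. if b then M else N) ` UNIV)) \<and>
    (\<forall>b\<in>UNIV. res E (\<Union>((\<lambda>b. if b then M else N) ` UNIV)) (if b then M else N) r = (if b then s else t))"
    using assms by (intro glue) (auto split: if_splits)
  moreover have "\<Union>((\<lambda>b. if b then M else N) ` UNIV) = M \<union> N" by auto
  ultimately show ?thesis by (simp add: all_bool_eq conj_commute)
qed

definition same_germ :: "'a \<Rightarrow> 'a set \<Rightarrow> 's \<Rightarrow> 'a set \<Rightarrow> 's \<Rightarrow> bool" where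
  "same_germ y U s V t \<longleftrightarrow> (\<exists>N. openin X N \<and> y \<in> N \<and> N \<subseteq> U \<inter> V \<and> res E U N s = res E V N t)"

lemma same_germ_sym: "same_germ y U s V t \<Longrightarrow> same_germ y V t U s"
  unfolding same_germ_def by (metis inf_commute)

lemma same_germ_trans:
  assumes op: "openin X U" "openin X V" "openin X W"
    and sec: "s \<in> sections E U" "t \<in> sections E V" "r \<in> sections E W"
    and g: "same_germ y U s V t" "same_germ y V t W r"
  shows "same_germ y U s W r"
proof -
  obtain M N where M: "openin X M" "y \<in> M" "M \<subseteq> U \<inter> V" "res E U M s = res E V M t"
    and N: "openin X N" "y \<in> N" "N \<subseteq> V \<inter> W" "res E V N t = res E W N r"
    using g by (auto simp: same_germ_def)
  have o: "openin X (M \<inter> N)" using M N by blast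
  have "res E U (M \<inter> N) s = res E M (M \<inter> N) (res E U M s)"
    using M op sec o by (intro res_res[symmetric]) auto
  also have "\<dots> = res E V (M \<inter> N) t"
    unfolding M(4) using M op sec o by (intro res_res) auto
  also have "\<dots> = res E N (M \<inter> N) (res E V N t)"
    using N op sec o by (intro res_res[symmetric]) auto
  also have "\<dots> = res E W (M \<inter> N) r"
    unfolding N(4) using N op sec o by (intro res_res) auto
  finally show ?thesis
    unfolding same_germ_def using o M N by blast
qed

lemma same_germ_res:
  assumes "openin X U" "openin X N" "N \<subseteq> U" "s \<in> sections E U" "y \<in> N"
  shows "same_germ y U s N (res E U N s)"
  unfolding same_germ_def using assms res_self[OF assms(2) res_closed[OF assms(1-4)]]
  by (intro exI[of _ N]) auto

text \<open>
  Separation in terms of germs: the neighbourhoods that witness equality of the germs cover \<open>N\<close>.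
\<close>

lemma res_eqI:
  assumes op: "openin X U" "openin X V" "openin X N" "N \<subseteq> U" "N \<subseteq> V"
    and sec: "s \<in> sections E U" "t \<in> sections E V"
    and germ: "\<And>y. y \<in> N \<Longrightarrow> same_germ y U s V t"
  shows "res E U N s = res E V N t"
proof -
  obtain K where K: "\<And>y. y \<in> N \<Longrightarrow> openin X (K y) \<and> y \<in> K y \<and> K y \<subseteq> U \<inter> V \<and> res E U (K y) s = res E V (K y) t"
    using germ unfolding same_germ_def by metis
  have o: "openin X (K y \<inter> N)" if "y \<in> N" for y using K[OF that] op by blast
  show ?thesis
  proof (rule section_eqI[where I = N and N = "\<lambda>y. K y \<inter> N"])
    show "N = (\<Union>y\<in>N. K y \<inter> N)" using K by blast
    fix y assume y: "y \<in> N"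
    have "res E N (K y \<inter> N) (res E U N s) = res E U (K y \<inter> N) s"
      using o[OF y] op sec by (intro res_res) auto
    also have "\<dots> = res E (K y) (K y \<inter> N) (res E U (K y) s)"
      using K[OF y] o[OF y] op sec by (intro res_res[symmetric]) auto
    also have "\<dots> = res E (K y) (K y \<inter> N) (res E V (K y) t)"
      using K[OF y] by simp
    also have "\<dots> = res E V (K y \<inter> N) t"
      using K[OF y] o[OF y] op sec by (intro res_res) auto
    also have "\<dots> = res E N (K y \<inter> N) (res E V N t)"
      using o[OF y] op sec by (intro res_res[symmetric]) auto
    finally show "res E N (K y \<inter> N) (res E U N s) = res E N (K y \<inter> N) (res E V N t)" .
  qed (use o op sec res_closed in auto)
qed

end


section \<open>The skew lattice of a sheaf and its germs\<close>

locale front_object = sheaf_on "front Y" E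
  for Y :: "'a topology" and E :: "('a, 's) presheaf" +
  assumes global_section: "sections E (topspace (front Y)) \<noteq> {}"
begin

lemma section_exists: "openin (front Y) N \<Longrightarrow> \<exists>s. s \<in> sections E N"
  using global_section res_closed[OF openin_topspace _ openin_subset] by blast

text \<open>
  A neighbourhood \<open>U \<inter> C\<close> of \<open>y\<close> in \<open>N\<close>, with \<open>U\<close> open and \<open>C\<close> closed, is complemented in \<open>U\<close> by the
  front-open set \<open>U - C\<close>. So \<open>s\<close> extends from \<open>U \<inter> C\<close> to \<open>U\<close>; on \<open>U - C\<close> any section will do, and
  one exists because \<open>E\<close> has a global section. It is this step that makes the sections over
  open sets of \<open>Y\<close>, the elements of the skew lattice, determine all of \<open>E\<close>.
\<close>

lemma extend_germ:
  assumes N: "openin (front Y) N" "s \<in> sections E N" "y \<in> N"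
  obtains U r where "openin Y U" "r \<in> sections E U" "y \<in> U" "same_germ y N s U r"
proof -
  obtain U C where UC: "openin Y U" "closedin Y C" "y \<in> U \<inter> C" "U \<inter> C \<subseteq> N"
    using front_neighbourhood[OF N(1,3)] by metis
  have o: "openin (front Y) (U \<inter> C)" "openin (front Y) (U - C)"
    using UC locally_closedin_imp_openin_front[of Y "U \<inter> C"]
    by (auto simp: locally_closedin_def intro: openin_imp_openin_front openin_diff)
  obtain u where "u \<in> sections E (U - C)" using section_exists o by blast
  then obtain r where r: "r \<in> sections E ((U \<inter> C) \<union> (U - C))"
      "res E ((U \<inter> C) \<union> (U - C)) (U \<inter> C) r = res E N (U \<inter> C) s"
    using glue_disjoint[OF o _ res_closed[OF N(1) o(1) UC(4) N(2)]] by blast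
  moreover have "(U \<inter> C) \<union> (U - C) = U" by blast
  ultimately have "r \<in> sections E U" "same_germ y N s U r"
    unfolding same_germ_def using o UC by auto
  then show ?thesis using that UC by blast
qed

definition A :: "('a set \<times> 's) skew_lattice" where
  "A = H (Y, E)"

lemma carrier_A: "(U, s) \<in> carrier A \<longleftrightarrow> openin Y U \<and> s \<in> sections E U"
  by (simp add: A_def)

lemma carrier_A_front: "(U, s) \<in> carrier A \<Longrightarrow> openin (front Y) U \<and> s \<in> sections E U"
  by (simp add: carrier_A openin_imp_openin_front)

lemma meet_A: "(U, s) \<curlywedge>\<^bsub>A\<^esub> (V, t) = (U \<inter> V, res E U (U \<inter> V) s)"
  by (simp add: A_def)

lemma meet_A_closed: "a \<in> carrier A \<Longrightarrow> b \<in> carrier A \<Longrightarrow> a \<curlywedge>\<^bsub>A\<^esub> b \<in> carrier A"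
  by (cases a; cases b)
    (auto simp: meet_A carrier_A intro!: res_closed openin_imp_openin_front openin_Int)

text \<open>
  The description in the definition of the join determines a section, since \<open>U - V\<close> and \<open>V\<close> are
  disjoint and front-open.
\<close>

lemma join_A_eq_iff:
  assumes "(U, s) \<in> carrier A" "(V, t) \<in> carrier A"
  shows "(U, s) \<curlyvee>\<^bsub>A\<^esub> (V, t) = (W, r) \<longleftrightarrow> W = U \<union> V \<and> r \<in> sections E (U \<union> V) \<and>
    res E (U \<union> V) (U - V) r = res E U (U - V) s \<and> res E (U \<union> V) V r = t"
proof -
  let ?P = "\<lambda>r. r \<in> sections E (U \<union> V) \<and>
    res E (U \<union> V) (U - V) r = res E U (U - V) s \<and> res E (U \<union> V) V r = t"
  have o: "openin (front Y) (U - V)" "openin (front Y) V" "openin (front Y) U"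
    using assms by (auto simp: carrier_A openin_front_Diff openin_imp_openin_front)
  have "\<exists>!r. r \<in> sections E ((U - V) \<union> V) \<and>
    res E ((U - V) \<union> V) (U - V) r = res E U (U - V) s \<and> res E ((U - V) \<union> V) V r = t"
    using o assms by (intro glue_disjoint res_closed) (auto simp: carrier_A)
  moreover have "(U - V) \<union> V = U \<union> V" by blast
  ultimately have ex: "\<exists>!r. ?P r" by simp
  have "(U, s) \<curlyvee>\<^bsub>A\<^esub> (V, t) = (U \<union> V, THE r. ?P r)" by (simp add: A_def)
  then show ?thesis using theI'[OF ex] ex by auto
qed

text \<open>
  Joining with \<open>(C, c)\<close> on the right overwrites everything over \<open>C\<close> and keeps the rest.
\<close>

lemma join_A_cong_iff:
  assumes "(U, s) \<in> carrier A" "(V, t) \<in> carrier A" "(C, c) \<in> carrier A"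
  shows "(U, s) \<curlyvee>\<^bsub>A\<^esub> (C, c) = (V, t) \<curlyvee>\<^bsub>A\<^esub> (C, c) \<longleftrightarrow>
    U - C = V - C \<and> res E U (U - C) s = res E V (U - C) t"
proof -
  obtain W r where r: "(U, s) \<curlyvee>\<^bsub>A\<^esub> (C, c) = (W, r)" by fastforce
  have rU: "W = U \<union> C" "r \<in> sections E (U \<union> C)"
    "res E (U \<union> C) (U - C) r = res E U (U - C) s" "res E (U \<union> C) C r = c"
    using r join_A_eq_iff[OF assms(1,3)] by auto
  have "(V, t) \<curlyvee>\<^bsub>A\<^esub> (C, c) = (W, r) \<longleftrightarrow> W = V \<union> C \<and> r \<in> sections E (V \<union> C) \<and>
    res E (V \<union> C) (V - C) r = res E V (V - C) t \<and> res E (V \<union> C) C r = c"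
    by (rule join_A_eq_iff[OF assms(2,3)])
  moreover have "U \<union> C = V \<union> C \<longleftrightarrow> U - C = V - C" by blast
  ultimately show ?thesis using r rU by (metis (no_types, lifting))
qed

definition open_class :: "'a set \<Rightarrow> ('a set \<times> 's) set" where
  "open_class U = {U} \<times> sections E U"

lemma greenD_A_iff:
  "((U, s), (V, t)) \<in> greenD A \<longleftrightarrow> (U, s) \<in> carrier A \<and> (V, t) \<in> carrier A \<and> U = V"
proof -
  have "(U, s) \<curlywedge>\<^bsub>A\<^esub> (V, t) \<curlywedge>\<^bsub>A\<^esub> (U, s) = (U, s)" if "(U, s) \<in> carrier A" "U \<subseteq> V" for U s V t
    using that carrier_A_front[OF that(1)]
    by (simp add: meet_A Int_absorb2 Int_absorb1 res_self)
  moreover have "U \<subseteq> V" if "(U, s) \<curlywedge>\<^bsub>A\<^esub> (V, t) \<curlywedge>\<^bsub>A\<^esub> (U, s) = (U, s)" for U s V t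
    using that by (auto simp: meet_A)
  ultimately show ?thesis
    unfolding greenD_def by (simp, blast)
qed

lemma Dclass_A: "(U, s) \<in> carrier A \<Longrightarrow> Dclass A (U, s) = open_class U"
  by (auto simp: Dclass_def open_class_def greenD_A_iff carrier_A)

lemma carrier_Dquot: "carrier (Dquot A) = open_class ` {U. openin Y U}"
proof -
  have "carrier (Dquot A) = Dclass A ` carrier A"
    by (auto simp: Dquot_def quotient_def Dclass_def)
  also have "\<dots> = open_class ` {U. openin Y U}"
  proof (intro equalityI subsetI)
    fix C assume "C \<in> open_class ` {U. openin Y U}"
    then obtain U where U: "openin Y U" "C = open_class U" by blast
    then obtain s where "(U, s) \<in> carrier A"
      using section_exists[OF openin_imp_openin_front] by (auto simp: carrier_A)
    then show "C \<in> Dclass A ` carrier A" using U Dclass_A by blast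
  qed (auto simp: Dclass_A, auto simp: carrier_A)
  finally show ?thesis .
qed

lemma open_class_le_iff:
  assumes "openin Y U" "openin Y V"
  shows "open_class U \<sqsubseteq>\<^bsub>Dquot A\<^esub> open_class V \<longleftrightarrow> U \<subseteq> V"
proof
  assume "open_class U \<sqsubseteq>\<^bsub>Dquot A\<^esub> open_class V"
  then have "\<exists>a\<in>open_class U. \<exists>b\<in>open_class V. a \<curlywedge>\<^bsub>A\<^esub> b \<in> open_class U" by (simp add: Dquot_def)
  then show "U \<subseteq> V" by (auto simp: open_class_def meet_A)
next
  assume "U \<subseteq> V"
  moreover obtain s t where "s \<in> sections E U" "t \<in> sections E V"
    using section_exists[OF openin_imp_openin_front[OF assms(1)]]
      section_exists[OF openin_imp_openin_front[OF assms(2)]] by auto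
  ultimately have "(U, s) \<curlywedge>\<^bsub>A\<^esub> (V, t) \<in> open_class U" "(U, s) \<in> open_class U" "(V, t) \<in> open_class V"
    using assms by (simp_all add: open_class_def meet_A Int_absorb2 res_self openin_imp_openin_front)
  then have "\<exists>a\<in>open_class U. \<exists>b\<in>open_class V. a \<curlywedge>\<^bsub>A\<^esub> b \<in> open_class U" by (meson bexI)
  then show "open_class U \<sqsubseteq>\<^bsub>Dquot A\<^esub> open_class V" by (simp add: Dquot_def)
qed

text \<open>
  By \<open>carrier_Dquot\<close> and \<open>open_class_le_iff\<close>, \<open>open_class\<close> is an isomorphism from the frame of open
  sets of \<open>Y\<close> to \<open>A / D\<close>, and the frame structure is transported along it.
\<close>

lemma frame_Dquot: "frame (Dquot A)"
  and Dquot_sup: "K \<subseteq> {U. openin Y U} \<Longrightarrow> \<Squnion>\<^bsub>Dquot A\<^esub>(open_class ` K) = open_class (\<Union>K)"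
  and Dquot_meet: "openin Y U \<Longrightarrow> openin Y V \<Longrightarrow> open_class U \<sqinter>\<^bsub>Dquot A\<^esub> open_class V = open_class (U \<inter> V)"
  and Dquot_top: "\<top>\<^bsub>Dquot A\<^esub> = open_class (topspace Y)"
proof -
  let ?L = "Dquot A"
  have eq: "(.=\<^bsub>?L\<^esub>) = (=)" by (simp add: Dquot_def)
  interpret partial_order ?L
    by unfold_locales (auto simp: eq carrier_Dquot open_class_le_iff)
  have up: "open_class W \<in> Upper ?L (open_class ` K) \<longleftrightarrow> (\<forall>U\<in>K. U \<subseteq> W)"
    and low: "open_class W \<in> Lower ?L (open_class ` K) \<longleftrightarrow> (\<forall>U\<in>K. W \<subseteq> U)"
    if "K \<subseteq> {U. openin Y U}" "openin Y W" for K W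
  proof -
    have *: "open_class ` K \<subseteq> carrier ?L" "open_class W \<in> carrier ?L"
      using that carrier_Dquot by auto
    then have "open_class W \<in> Upper ?L (open_class ` K) \<longleftrightarrow> (\<forall>U\<in>K. open_class U \<sqsubseteq>\<^bsub>?L\<^esub> open_class W)"
        "open_class W \<in> Lower ?L (open_class ` K) \<longleftrightarrow> (\<forall>U\<in>K. open_class W \<sqsubseteq>\<^bsub>?L\<^esub> open_class U)"
      by (auto simp: Upper_def Lower_def)
    moreover have "open_class U \<sqsubseteq>\<^bsub>?L\<^esub> open_class W \<longleftrightarrow> U \<subseteq> W" "open_class W \<sqsubseteq>\<^bsub>?L\<^esub> open_class U \<longleftrightarrow> W \<subseteq> U" if "U \<in> K" for U
      using that \<open>K \<subseteq> _\<close> \<open>openin Y W\<close> by (auto simp: open_class_le_iff subset_iff[of K])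
    ultimately show "open_class W \<in> Upper ?L (open_class ` K) \<longleftrightarrow> (\<forall>U\<in>K. U \<subseteq> W)"
        "open_class W \<in> Lower ?L (open_class ` K) \<longleftrightarrow> (\<forall>U\<in>K. W \<subseteq> U)"
      by auto
  qed
  have l: "least ?L (open_class (\<Union>K)) (Upper ?L (open_class ` K))" if K: "K \<subseteq> {U. openin Y U}" for K
  proof -
    have o: "openin Y (\<Union>K)" using K by auto
    have "open_class (\<Union>K) \<sqsubseteq>\<^bsub>?L\<^esub> C" if C: "C \<in> Upper ?L (open_class ` K)" for C
    proof -
      obtain W where W: "openin Y W" "C = open_class W"
        using subsetD[OF Upper_closed C] carrier_Dquot by auto
      then have "\<Union>K \<subseteq> W" using up[OF K W(1)] C by blast
      then show ?thesis using open_class_le_iff[OF o W(1)] W(2) by simp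
    qed
    then show ?thesis
      unfolding least_def using up[OF K o] by auto
  qed
  have g: "greatest ?L (open_class (\<Union>{V. openin Y V \<and> (\<forall>U\<in>K. V \<subseteq> U)})) (Lower ?L (open_class ` K))"
    (is "greatest ?L (open_class ?I) _") if K: "K \<subseteq> {U. openin Y U}" for K
  proof -
    have o: "openin Y ?I" by auto
    have "C \<sqsubseteq>\<^bsub>?L\<^esub> open_class ?I" if C: "C \<in> Lower ?L (open_class ` K)" for C
    proof -
      obtain W where W: "openin Y W" "C = open_class W"
        using subsetD[OF Lower_closed C] carrier_Dquot by auto
      then have "W \<subseteq> ?I" using low[OF K W(1)] C by blast
      then show ?thesis using open_class_le_iff[OF W(1) o] W(2) by simp
    qed
    then show ?thesis
      unfolding greatest_def using low[OF K o] by auto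
  qed
  have im: "\<exists>K\<subseteq>{U. openin Y U}. S = open_class ` K" if "S \<subseteq> carrier ?L" for S
    using that unfolding carrier_Dquot subset_image_iff .
  have lub: "\<exists>s. least ?L s (Upper ?L S)" and glb: "\<exists>i. greatest ?L i (Lower ?L S)"
    if "S \<subseteq> carrier ?L" for S
  proof -
    obtain K where K: "K \<subseteq> {U. openin Y U}" "S = open_class ` K" using im[OF \<open>S \<subseteq> carrier ?L\<close>] by auto
    show "\<exists>s. least ?L s (Upper ?L S)" unfolding K(2) by (rule exI) (rule l[OF K(1)])
    show "\<exists>i. greatest ?L i (Lower ?L S)" unfolding K(2) by (rule exI) (rule g[OF K(1)])
  qed
  interpret complete_lattice ?L
    by unfold_locales (fact lub glb)+
  have s: "\<Squnion>\<^bsub>?L\<^esub>(open_class ` K) = open_class (\<Union>K)" if "K \<subseteq> {U. openin Y U}" for K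
    by (rule least_unique[OF sup_lub l[OF that]]) (use that carrier_Dquot in auto)
  have m: "open_class U \<sqinter>\<^bsub>?L\<^esub> open_class V = open_class (U \<inter> V)" if "openin Y U" "openin Y V" for U V
  proof -
    have "\<Union>{W. openin Y W \<and> (\<forall>Z\<in>{U, V}. W \<subseteq> Z)} = U \<inter> V"
      using openin_Int[OF that] by blast
    then have "greatest ?L (open_class (U \<inter> V)) (Lower ?L {open_class U, open_class V})"
      using g[of "{U, V}"] that by simp
    moreover have "{open_class U, open_class V} \<subseteq> carrier ?L" using that carrier_Dquot by auto
    ultimately show ?thesis
      unfolding meet_def by (intro greatest_unique[OF inf_glb])
  qed
  show "K \<subseteq> {U. openin Y U} \<Longrightarrow> \<Squnion>\<^bsub>?L\<^esub>(open_class ` K) = open_class (\<Union>K)" by (rule s)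
  show "openin Y U \<Longrightarrow> openin Y V \<Longrightarrow> open_class U \<sqinter>\<^bsub>?L\<^esub> open_class V = open_class (U \<inter> V)" by (rule m)
  obtain T where T: "openin Y T" "\<top>\<^bsub>?L\<^esub> = open_class T"
    using top_closed carrier_Dquot by auto
  have "open_class (topspace Y) \<sqsubseteq>\<^bsub>?L\<^esub> \<top>\<^bsub>?L\<^esub>"
    by (rule top_higher) (auto simp: carrier_Dquot)
  then have "topspace Y \<subseteq> T" using T open_class_le_iff by simp
  then show "\<top>\<^bsub>?L\<^esub> = open_class (topspace Y)"
    using T(2) openin_subset[OF T(1)] by (simp add: subset_antisym)
  show "frame ?L"
  proof unfold_locales
    fix a S assume "a \<in> carrier ?L" "S \<subseteq> carrier ?L"
    then obtain U where U: "openin Y U" "a = open_class U" using carrier_Dquot by auto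
    obtain K where K: "K \<subseteq> {U. openin Y U}" "S = open_class ` K"
      using im[OF \<open>S \<subseteq> carrier ?L\<close>] by auto
    have o: "openin Y (\<Union>K)" using K(1) by auto
    have "a \<sqinter>\<^bsub>?L\<^esub> \<Squnion>\<^bsub>?L\<^esub>S = open_class (U \<inter> \<Union>K)"
      unfolding U(2) K(2) s[OF K(1)] using U(1) o by (rule m)
    also have "U \<inter> \<Union>K = \<Union>((\<lambda>V. U \<inter> V) ` K)" by blast
    also have "open_class \<dots> = \<Squnion>\<^bsub>?L\<^esub>(open_class ` (\<lambda>V. U \<inter> V) ` K)"
      using U(1) K(1) by (intro s[symmetric]) auto
    also have "open_class ` (\<lambda>V. U \<inter> V) ` K = (\<lambda>s. a \<sqinter>\<^bsub>?L\<^esub> s) ` S"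
      unfolding U(2) K(2) image_image using U(1) K(1) m by (intro image_cong) auto
    finally show "a \<sqinter>\<^bsub>?L\<^esub> \<Squnion>\<^bsub>?L\<^esub>S = \<Squnion>\<^bsub>?L\<^esub>((\<lambda>s. a \<sqinter>\<^bsub>?L\<^esub> s) ` S)" .
  qed
qed

lemma points_Dquot_iff:
  "p \<in> points (Dquot A) \<longleftrightarrow> p \<in> extensional (open_class ` {U. openin Y U}) \<and> p (open_class (topspace Y)) \<and>
     (\<forall>U V. openin Y U \<longrightarrow> openin Y V \<longrightarrow> (p (open_class (U \<inter> V)) \<longleftrightarrow> p (open_class U) \<and> p (open_class V))) \<and>
     (\<forall>K\<subseteq>{U. openin Y U}. p (open_class (\<Union>K)) \<longleftrightarrow> (\<exists>U\<in>K. p (open_class U)))"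
proof -
  have "(\<forall>S\<subseteq>carrier (Dquot A). p (\<Squnion>\<^bsub>Dquot A\<^esub>S) \<longleftrightarrow> (\<exists>C\<in>S. p C)) \<longleftrightarrow>
    (\<forall>K\<subseteq>{U. openin Y U}. p (open_class (\<Union>K)) \<longleftrightarrow> (\<exists>U\<in>K. p (open_class U)))"
    unfolding carrier_Dquot all_subset_image by (simp add: Dquot_sup)
  then show ?thesis
    unfolding points_iff by (simp add: carrier_Dquot Dquot_top Dquot_meet)
qed

definition f :: "'a \<Rightarrow> ('a set \<times> 's) set \<Rightarrow> bool" where
  "f = natural_map (Y, E)"

lemma f_eq: "f y = (\<lambda>C\<in>carrier (Dquot A). \<exists>(U, s)\<in>C. y \<in> U)"
  unfolding f_def natural_map_def A_def ..

lemma f_open_class: "openin Y U \<Longrightarrow> f y (open_class U) \<longleftrightarrow> y \<in> U"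
  using section_exists[OF openin_imp_openin_front, of U]
  by (auto simp: f_eq carrier_Dquot open_class_def)

lemma f_Dclass: "(U, s) \<in> carrier A \<Longrightarrow> f y (Dclass A (U, s)) \<longleftrightarrow> y \<in> U"
  by (simp add: Dclass_A f_open_class carrier_A)

lemma f_in_points: "y \<in> topspace Y \<Longrightarrow> f y \<in> points (Dquot A)"
proof -
  assume y: "y \<in> topspace Y"
  have "f y \<in> extensional (open_class ` {U. openin Y U})"
    by (simp add: f_eq flip: carrier_Dquot)
  moreover have "f y (open_class (\<Union>K)) \<longleftrightarrow> (\<exists>U\<in>K. f y (open_class U))" if "K \<subseteq> {U. openin Y U}" for K
  proof -
    have "openin Y (\<Union>K)" using that by auto
    then show ?thesis using that by (auto simp: f_open_class subset_iff)
  qed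
  ultimately show ?thesis
    using y by (simp add: points_Dquot_iff f_open_class openin_Int)
qed

lemma Uset_A: "(U, s) \<in> carrier A \<Longrightarrow> Uset A (U, s) = pt_open (Dquot A) (open_class U)"
  by (simp add: Uset_def Dclass_A)

lemma f_in_pt_open: "y \<in> topspace Y \<Longrightarrow> openin Y U \<Longrightarrow> f y \<in> pt_open (Dquot A) (open_class U) \<longleftrightarrow> y \<in> U"
  by (simp add: pt_open_def f_in_points f_open_class)

lemma f_in_Uset: "y \<in> topspace Y \<Longrightarrow> (U, s) \<in> carrier A \<Longrightarrow> f y \<in> Uset A (U, s) \<longleftrightarrow> y \<in> U"
  by (simp add: Uset_A f_in_pt_open carrier_A)

lemma openin_Yspace: "openin (Yspace A) W \<longleftrightarrow> (\<exists>U. openin Y U \<and> W = pt_open (Dquot A) (open_class U))"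
  by (auto simp: Yspace_def openin_pt[OF frame_Dquot] carrier_Dquot)

lemma topspace_Yspace: "topspace (Yspace A) = points (Dquot A)"
  by (simp add: Yspace_def topspace_pt[OF frame_Dquot])

text \<open>
  With \<open>c\<close> over \<open>C\<close> and \<open>d\<close> over \<open>D\<close>, the equation in the definition of \<open>germ_eq\<close> says that \<open>U \<inter> D\<close> and
  \<open>V \<inter> D\<close> coincide outside \<open>C\<close> and that \<open>s\<close> and \<open>t\<close> agree there. This set is front-open and contains \<open>y\<close>,
  which gives one direction. For the other, a front neighbourhood of \<open>y\<close> on which \<open>s\<close> and \<open>t\<close> agree
  contains one of the form \<open>D - C\<close>, and sections \<open>c\<close> over \<open>C\<close> and \<open>d\<close> over \<open>D\<close> exist because \<open>E\<close> has a
  global section.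
\<close>

lemma germ_eq_iff:
  assumes a: "(U, s) \<in> carrier A" "(V, t) \<in> carrier A" and y: "y \<in> U" "y \<in> V"
  shows "germ_eq A (f y) (U, s) (V, t) \<longleftrightarrow> same_germ y U s V t"
proof -
  have fU: "openin (front Y) U" "s \<in> sections E U" and fV: "openin (front Y) V" "t \<in> sections E V"
    using a carrier_A_front by auto
  have key: "((U, s) \<curlywedge>\<^bsub>A\<^esub> (D, d)) \<curlyvee>\<^bsub>A\<^esub> (C, c) = ((V, t) \<curlywedge>\<^bsub>A\<^esub> (D, d)) \<curlyvee>\<^bsub>A\<^esub> (C, c) \<longleftrightarrow>
      U \<inter> D - C = V \<inter> D - C \<and> res E U (U \<inter> D - C) s = res E V (U \<inter> D - C) t"
    if D: "(D, d) \<in> carrier A" and C: "(C, c) \<in> carrier A" for C c D d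
  proof -
    have o: "openin (front Y) (U \<inter> D)" "openin (front Y) (V \<inter> D)"
        "openin (front Y) (U \<inter> D - C)" "openin (front Y) (V \<inter> D - C)"
      using a D C by (auto simp: carrier_A intro: openin_imp_openin_front openin_front_Diff openin_Int)
    have 1: "res E (U \<inter> D) (U \<inter> D - C) (res E U (U \<inter> D) s) = res E U (U \<inter> D - C) s"
      using o fU by (intro res_res) auto
    have 2: "res E (V \<inter> D) (V \<inter> D - C) (res E V (V \<inter> D) t) = res E V (V \<inter> D - C) t"
      using o fV by (intro res_res) auto
    have m: "(U \<inter> D, res E U (U \<inter> D) s) \<in> carrier A" "(V \<inter> D, res E V (V \<inter> D) t) \<in> carrier A"
      using meet_A_closed[OF a(1) D] meet_A_closed[OF a(2) D] by (simp_all add: meet_A)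
    show ?thesis
      using join_A_cong_iff[OF m C] 1 2 by (auto simp: meet_A)
  qed
  show ?thesis
  proof
    assume "germ_eq A (f y) (U, s) (V, t)"
    then obtain C c D d where CD: "(C, c) \<in> carrier A" "(D, d) \<in> carrier A"
        "\<not> f y (Dclass A (C, c))" "f y (Dclass A (D, d))"
        "((U, s) \<curlywedge>\<^bsub>A\<^esub> (D, d)) \<curlyvee>\<^bsub>A\<^esub> (C, c) = ((V, t) \<curlywedge>\<^bsub>A\<^esub> (D, d)) \<curlyvee>\<^bsub>A\<^esub> (C, c)"
      unfolding germ_eq_def by auto
    have "y \<notin> C" "y \<in> D" using CD f_Dclass by blast+
    moreover have "openin (front Y) (U \<inter> D - C)"
      using a CD by (auto simp: carrier_A intro!: openin_front_Diff openin_Int)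
    ultimately show "same_germ y U s V t"
      unfolding same_germ_def using CD(5)[unfolded key[OF CD(2,1)]] y
      by (intro exI[of _ "U \<inter> D - C"]) blast
  next
    assume "same_germ y U s V t"
    then obtain N where N: "openin (front Y) N" "y \<in> N" "N \<subseteq> U \<inter> V" "res E U N s = res E V N t"
      by (auto simp: same_germ_def)
    then obtain D0 K where DK: "openin Y D0" "closedin Y K" "y \<in> D0 \<inter> K" "D0 \<inter> K \<subseteq> N"
      using front_neighbourhood[OF N(1,2)] by metis
    \<comment> \<open>Shrinking \<open>D0\<close> into \<open>U \<inter> V\<close> makes \<open>U \<inter> D\<close> and \<open>V \<inter> D\<close> both equal to \<open>D\<close>.\<close>
    define D where "D = D0 \<inter> U \<inter> V"
    define C where "C = topspace Y - K"
    have o: "openin Y D" "openin Y C"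
      using DK a by (auto simp: D_def C_def carrier_A)
    obtain c d where cd: "(C, c) \<in> carrier A" "(D, d) \<in> carrier A"
      using section_exists[OF openin_imp_openin_front[OF o(1)]]
        section_exists[OF openin_imp_openin_front[OF o(2)]] o by (auto simp: carrier_A)
    have "U \<inter> D - C = D - C" "V \<inter> D - C = D - C" "D - C \<subseteq> N"
      using DK openin_subset[OF o(1)] by (auto simp: D_def C_def)
    moreover have "res E U (D - C) s = res E V (D - C) t"
    proof -
      have "openin (front Y) (D - C)" using o by (rule openin_front_Diff)
      then have "res E N (D - C) (res E U N s) = res E U (D - C) s"
          "res E N (D - C) (res E V N t) = res E V (D - C) t"
        using N(1-3) \<open>D - C \<subseteq> N\<close> fU fV by (auto intro!: res_res)
      then show ?thesis using N(4) by simp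
    qed
    ultimately have "((U, s) \<curlywedge>\<^bsub>A\<^esub> (D, d)) \<curlyvee>\<^bsub>A\<^esub> (C, c) = ((V, t) \<curlywedge>\<^bsub>A\<^esub> (D, d)) \<curlyvee>\<^bsub>A\<^esub> (C, c)"
      using key[OF cd(2,1)] by simp
    moreover have "\<not> f y (Dclass A (C, c))" "f y (Dclass A (D, d))"
      using f_Dclass[OF cd(1)] f_Dclass[OF cd(2)] DK y by (auto simp: C_def D_def)
    ultimately show "germ_eq A (f y) (U, s) (V, t)"
      unfolding germ_eq_def using cd by (intro bexI conjI)
  qed
qed

lemma gsec_eq_iff:
  assumes a: "(U, s) \<in> carrier A" "(V, t) \<in> carrier A" and y: "y \<in> U" "y \<in> V"
  shows "gsec A (U, s) (f y) = gsec A (V, t) (f y) \<longleftrightarrow> same_germ y U s V t"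
proof -
  have yT: "y \<in> topspace Y" using y a openin_subset by (auto simp: carrier_A)
  have germ: "germ A (f y) (U, s) = {(W, r). (W, r) \<in> carrier A \<and> y \<in> W \<and> same_germ y U s W r}"
    if "(U, s) \<in> carrier A" "y \<in> U" for U s
    using that by (auto simp: germ_def f_Dclass germ_eq_iff)
  have refl: "same_germ y V t V t"
    using a y carrier_A_front[OF a(2)] same_germ_res[of V V t y] by (simp add: res_self)
  have trans: "same_germ y U s W r \<longleftrightarrow> same_germ y V t W r"
    if "same_germ y U s V t" "(W, r) \<in> carrier A" for W r
    using that a carrier_A_front
      same_germ_trans[of U V W s t r y] same_germ_trans[of V U W t s r y] same_germ_sym[of y U s V t]
    by blast
  have "germ A (f y) (U, s) = germ A (f y) (V, t) \<longleftrightarrow> same_germ y U s V t"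
  proof
    assume "germ A (f y) (U, s) = germ A (f y) (V, t)"
    moreover have "(V, t) \<in> germ A (f y) (V, t)"
      unfolding germ[OF a(2) y(2)] using refl a y by simp
    ultimately have "(V, t) \<in> germ A (f y) (U, s)" by simp
    then show "same_germ y U s V t"
      unfolding germ[OF a(1) y(1)] by simp
  next
    assume "same_germ y U s V t"
    then show "germ A (f y) (U, s) = germ A (f y) (V, t)"
      unfolding germ[OF a(1) y(1)] germ[OF a(2) y(2)] using trans by auto
  qed
  then show ?thesis
    using f_in_Uset yT a y by (simp add: gsec_def)
qed

lemma fst_gsec: "p \<in> Uset A a \<Longrightarrow> fst (gsec A a p) = p"
  by (simp add: gsec_def)

end


section \<open>The sheaf of a skew lattice\<close>

text \<open>
  Compatible continuous sections of a map paste to a function, which is continuous because continuity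
  is local on front-open covers.
\<close>

lemma sheaf_Esheaf: "is_sheaf (front (Yspace B)) (Esheaf B)"
proof -
  let ?X = "front (Yspace B)" and ?E = "Espace B"
  have mem: "\<sigma> \<in> sections (Esheaf B) W \<longleftrightarrow> \<sigma> \<in> extensional W \<and>
      continuous_map (subtopology ?X W) ?E \<sigma> \<and> (\<forall>p\<in>W. fst (\<sigma> p) = p)" for \<sigma> W
    by (simp add: Esheaf_def)
  have res: "res (Esheaf B) W W' \<sigma> = restrict \<sigma> W'" for W W' \<sigma>
    by (simp add: Esheaf_def)
  have res_mem: "restrict \<sigma> W' \<in> sections (Esheaf B) W'"
    if \<sigma>: "\<sigma> \<in> sections (Esheaf B) W" and sub: "W' \<subseteq> W" for \<sigma> W W'
  proof -
    have "continuous_map (subtopology ?X W') ?E \<sigma>"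
      using \<sigma> sub unfolding mem by (blast intro: continuous_map_from_subtopology_mono)
    then have "continuous_map (subtopology ?X W') ?E (restrict \<sigma> W')"
      by (rule continuous_map_eq) simp
    then show ?thesis using \<sigma> sub by (auto simp: mem)
  qed
  have presheaf: "is_presheaf ?X (Esheaf B)"
    unfolding is_presheaf_def res
  proof (intro conjI allI impI ballI)
    show "(\<lambda>\<sigma>. restrict \<sigma> V) \<in> sections (Esheaf B) U \<rightarrow> sections (Esheaf B) V"
      if "openin ?X U \<and> openin ?X V \<and> V \<subseteq> U" for U V
      using that res_mem by blast
    show "restrict \<sigma> U = \<sigma>" if "\<sigma> \<in> sections (Esheaf B) U" for U \<sigma>
      using that by (simp add: mem extensional_restrict)
    show "restrict (restrict \<sigma> V) W = restrict \<sigma> W"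
      if "openin ?X U \<and> openin ?X V \<and> openin ?X W \<and> W \<subseteq> V \<and> V \<subseteq> U" for U V W and \<sigma> :: "_ \<Rightarrow> _"
      using that by (simp add: Int_absorb1)
  qed
  have glue: "\<exists>!s. s \<in> sections (Esheaf B) (\<Union>\<U>) \<and> (\<forall>U\<in>\<U>. res (Esheaf B) (\<Union>\<U>) U s = \<sigma> U)"
    if \<sigma>: "\<And>U. U \<in> \<U> \<Longrightarrow> openin ?X U \<and> \<sigma> U \<in> sections (Esheaf B) U"
      and compat: "\<And>U V. U \<in> \<U> \<Longrightarrow> V \<in> \<U> \<Longrightarrow>
        res (Esheaf B) U (U \<inter> V) (\<sigma> U) = res (Esheaf B) V (U \<inter> V) (\<sigma> V)" for \<U> \<sigma>
  proof -
    have agree: "\<sigma> U p = \<sigma> V p" if "U \<in> \<U>" "V \<in> \<U>" "p \<in> U" "p \<in> V" for U V p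
      using fun_cong[OF compat[OF that(1,2)], of p] that by (simp add: res)
    define s where "s = (\<lambda>p\<in>\<Union>\<U>. \<sigma> (SOME U. U \<in> \<U> \<and> p \<in> U) p)"
    have s: "s p = \<sigma> U p" if "U \<in> \<U>" "p \<in> U" for U p
    proof -
      define V where "V = (SOME U. U \<in> \<U> \<and> p \<in> U)"
      have "V \<in> \<U> \<and> p \<in> V"
        unfolding V_def by (rule someI[of _ U]) (simp add: that)
      moreover have "p \<in> \<Union>\<U>" using that by blast
      ultimately show ?thesis using agree[of V U p] that by (simp add: s_def flip: V_def)
    qed
    have "continuous_map (subtopology ?X (\<Union>\<U>)) ?E s"
    proof (rule pasting_lemma[where I = \<U> and T = "\<lambda>U. U" and f = \<sigma>])
      fix U assume U: "U \<in> \<U>"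
      show "openin (subtopology ?X (\<Union>\<U>)) U"
        using U \<sigma> by (auto simp: openin_subtopology)
      have "\<Union>\<U> \<inter> U = U" using U by blast
      then show "continuous_map (subtopology (subtopology ?X (\<Union>\<U>)) U) ?E (\<sigma> U)"
        using \<sigma>[OF U] by (simp add: mem subtopology_subtopology)
    next
      fix U V p assume "U \<in> \<U>" "V \<in> \<U>" "p \<in> topspace (subtopology ?X (\<Union>\<U>)) \<inter> U \<inter> V"
      then show "\<sigma> U p = \<sigma> V p" by (intro agree) auto
    next
      fix p assume "p \<in> topspace (subtopology ?X (\<Union>\<U>))"
      then obtain U where "U \<in> \<U>" "p \<in> U" by auto
      then show "\<exists>U. U \<in> \<U> \<and> p \<in> U \<and> s p = \<sigma> U p" using s by blast
    qed
    moreover have "fst (s p) = p" if p: "p \<in> \<Union>\<U>" for p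
    proof -
      obtain U where U: "U \<in> \<U>" "p \<in> U" using p by blast
      then show ?thesis using s[OF U] \<sigma>[OF U(1)] by (simp add: mem)
    qed
    ultimately have sec: "s \<in> sections (Esheaf B) (\<Union>\<U>)"
      by (simp add: mem s_def)
    have "restrict s U = \<sigma> U" if "U \<in> \<U>" for U
      using \<sigma>[OF that] by (intro extensionalityI[of _ U]) (simp_all add: mem s[OF that])
    moreover have "s' = s" if s': "s' \<in> sections (Esheaf B) (\<Union>\<U>)" "\<forall>U\<in>\<U>. restrict s' U = \<sigma> U" for s'
    proof (rule extensionalityI[of _ "\<Union>\<U>"])
      show "s' \<in> extensional (\<Union>\<U>)" "s \<in> extensional (\<Union>\<U>)" using s' sec by (auto simp: mem)
      fix p assume "p \<in> \<Union>\<U>"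
      then obtain U where U: "U \<in> \<U>" "p \<in> U" by blast
      then show "s' p = s p"
        using s[OF U] s'(2) by (metis restrict_apply')
    qed
    ultimately show ?thesis
      unfolding res using sec by (intro ex1I[of _ s]) (blast, metis)
  qed
  show ?thesis
    unfolding is_sheaf_def
  proof (intro conjI allI impI)
    show "is_presheaf ?X (Esheaf B)" by (rule presheaf)
    fix \<U> \<sigma>
    assume *: "(\<forall>U\<in>\<U>. openin ?X U \<and> \<sigma> U \<in> sections (Esheaf B) U) \<and>
      (\<forall>U\<in>\<U>. \<forall>V\<in>\<U>. res (Esheaf B) U (U \<inter> V) (\<sigma> U) = res (Esheaf B) V (U \<inter> V) (\<sigma> V))"
    show "\<exists>!s. s \<in> sections (Esheaf B) (\<Union>\<U>) \<and> (\<forall>U\<in>\<U>. res (Esheaf B) (\<Union>\<U>) U s = \<sigma> U)"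
    proof (rule glue)
      show "openin ?X U \<and> \<sigma> U \<in> sections (Esheaf B) U" if "U \<in> \<U>" for U
        using bspec[OF conjunct1[OF *] that] .
      show "res (Esheaf B) U (U \<inter> V) (\<sigma> U) = res (Esheaf B) V (U \<inter> V) (\<sigma> V)"
        if "U \<in> \<U>" "V \<in> \<U>" for U V
        using bspec[OF bspec[OF conjunct2[OF *] that(1)] that(2)] .
    qed
  qed
qed


section \<open>The natural map of a sober space\<close>

text \<open>
  Composing a point of \<open>A / D\<close> with \<open>open_class\<close> gives a point of the frame of open sets, and this
  identifies \<open>f\<close> with \<open>pt_of Y\<close>.
\<close>

lemma (in front_object) natural_map_bij:
  assumes "bij_betw (pt_of Y) (topspace Y) (points (open_frame Y))"
  shows "bij_betw f (topspace Y) (points (Dquot A))"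
  unfolding bij_betw_def
proof (intro conjI inj_onI equalityI subsetI)
  fix y y' assume y: "y \<in> topspace Y" "y' \<in> topspace Y" "f y = f y'"
  have "y \<in> U \<longleftrightarrow> y' \<in> U" if "openin Y U" for U
    using f_open_class[OF that] y(3) by metis
  then have "pt_of Y y = pt_of Y y'"
    unfolding pt_of_def by (intro restrict_ext) simp
  then show "y = y'" using assms y by (auto simp: bij_betw_def dest: inj_onD)
next
  fix p assume "p \<in> f ` topspace Y"
  then show "p \<in> points (Dquot A)" using f_in_points by blast
next
  fix p assume p: "p \<in> points (Dquot A)"
  let ?q = "\<lambda>U\<in>{U. openin Y U}. p (open_class U)"
  have "?q (\<Union>K) \<longleftrightarrow> (\<exists>U\<in>K. ?q U)" if "K \<subseteq> {U. openin Y U}" for K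
  proof -
    have "openin Y (\<Union>K)" using that by auto
    moreover have "p (open_class (\<Union>K)) \<longleftrightarrow> (\<exists>U\<in>K. p (open_class U))"
      using p that unfolding points_Dquot_iff by blast
    moreover have "(\<exists>U\<in>K. ?q U) \<longleftrightarrow> (\<exists>U\<in>K. p (open_class U))"
      using that by (intro bex_cong) auto
    ultimately show ?thesis by simp
  qed
  then have "?q \<in> points (open_frame Y)"
    using p unfolding points_open_frame_iff points_Dquot_iff by (simp add: openin_Int)
  then obtain y where y: "y \<in> topspace Y" "pt_of Y y = ?q"
    using assms by (metis bij_betw_def imageE)
  have "p = f y"
  proof (rule extensionalityI[of _ "open_class ` {U. openin Y U}"])
    show "p \<in> extensional (open_class ` {U. openin Y U})" "f y \<in> extensional (open_class ` {U. openin Y U})"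
      using p f_in_points[OF y(1)] unfolding points_Dquot_iff by auto
    fix C assume "C \<in> open_class ` {U. openin Y U}"
    then obtain U where U: "openin Y U" "C = open_class U" by blast
    then show "p C = f y C"
      using fun_cong[OF y(2), of U] by (simp add: f_open_class pt_of_def)
  qed
  then show "p \<in> f ` topspace Y" using y(1) by blast
qed

locale sober_object = front_object Y E for Y :: "'a topology" and E :: "('a, 's) presheaf" +
  assumes sober: "sober_space Y"
begin

lemma f_bij: "bij_betw f (topspace Y) (points (Dquot A))"
  using sober by (simp add: natural_map_bij sober_space_iff_pt_of_bij)

lemma f_surj: "p \<in> points (Dquot A) \<Longrightarrow> \<exists>y\<in>topspace Y. p = f y"
  using f_bij by (auto simp: bij_betw_def)

lemma homeomorphic_f: "homeomorphic_map Y (Yspace A) f"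
proof (rule bijective_open_imp_homeomorphic_map)
  show "continuous_map Y (Yspace A) f"
    unfolding continuous_map_def
  proof (intro conjI allI impI)
    show "f \<in> topspace Y \<rightarrow> topspace (Yspace A)"
      using f_in_points by (auto simp: topspace_Yspace)
    fix W assume "openin (Yspace A) W"
    then obtain U where U: "openin Y U" "W = pt_open (Dquot A) (open_class U)"
      by (auto simp: openin_Yspace)
    have "{y \<in> topspace Y. f y \<in> W} = U"
      using U openin_subset[OF U(1)] by (auto simp: f_in_pt_open)
    then show "openin Y {y \<in> topspace Y. f y \<in> W}" using U by simp
  qed
  show "open_map Y (Yspace A) f"
    unfolding open_map_def
  proof (intro allI impI)
    fix U assume U: "openin Y U"
    have "f ` U = pt_open (Dquot A) (open_class U)"
    proof (intro equalityI subsetI)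
      fix p assume p: "p \<in> pt_open (Dquot A) (open_class U)"
      then obtain y where "y \<in> topspace Y" "p = f y" using f_surj by (auto simp: pt_open_def)
      then show "p \<in> f ` U" using p U by (simp add: f_in_pt_open)
    next
      fix p assume "p \<in> f ` U"
      then show "p \<in> pt_open (Dquot A) (open_class U)"
        using U openin_subset[OF U] by (auto simp: f_in_pt_open)
    qed
    then show "openin (Yspace A) (f ` U)" using U by (auto simp: openin_Yspace)
  qed
  show "f ` topspace Y = topspace (Yspace A)" "inj_on f (topspace Y)"
    using f_bij by (auto simp: bij_betw_def topspace_Yspace)
qed

abbreviation pre :: "(('a set \<times> 's) set \<Rightarrow> bool) set \<Rightarrow> 'a set" where
  "pre \<equiv> preim Y f"

abbreviation front_pt :: "(('a set \<times> 's) set \<Rightarrow> bool) topology" where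
  "front_pt \<equiv> front (Yspace A)"

lemma openin_pre: "openin front_pt W \<Longrightarrow> openin (front Y) (pre W)"
  using openin_front_preim homeomorphic_imp_continuous_map[OF homeomorphic_f] .

lemma openin_f_image:
  assumes "openin (front Y) N"
  shows "openin front_pt (f ` N)"
proof -
  obtain g where g: "homeomorphic_maps Y (Yspace A) f g"
    using homeomorphic_f homeomorphic_map_maps by blast
  have N: "N \<subseteq> topspace Y" using openin_subset[OF assms] by (simp add: topspace_front)
  have gf: "g (f y) = y" if "y \<in> topspace Y" for y
    using g that by (simp add: homeomorphic_maps_def)
  have fg: "f (g p) = p" if "p \<in> topspace (Yspace A)" for p
    using g that by (simp add: homeomorphic_maps_def)
  have "f ` N = preim (Yspace A) g N"
  proof (intro equalityI subsetI)
    fix p assume "p \<in> f ` N"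
    then obtain y where "y \<in> N" "p = f y" by blast
    then show "p \<in> preim (Yspace A) g N"
      using N gf[of y] f_in_points[of y] by (auto simp: preim_def topspace_Yspace)
  next
    fix p assume p: "p \<in> preim (Yspace A) g N"
    then show "p \<in> f ` N" using fg[of p] by (intro image_eqI[of _ _ "g p"]) (auto simp: preim_def)
  qed
  then show ?thesis
    using g openin_front_preim[of "Yspace A" Y g N] assms by (simp add: homeomorphic_maps_def)
qed

lemma mem_pre: "y \<in> pre W \<longleftrightarrow> y \<in> topspace Y \<and> f y \<in> W"
  by (simp add: preim_def)

lemma pre_image: "N \<subseteq> topspace Y \<Longrightarrow> pre (f ` N) = N"
  using f_bij by (auto simp: preim_def bij_betw_def dest: inj_onD)

lemma image_pre:
  assumes "openin front_pt W" "p \<in> W"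
  obtains y where "y \<in> pre W" "p = f y"
proof -
  have "p \<in> points (Dquot A)"
    using openin_subset[OF assms(1)] assms(2) by (auto simp: topspace_front topspace_Yspace)
  then show ?thesis using that f_surj assms(2) by (auto simp: mem_pre)
qed

section \<open>Continuous sections and sections of the given sheaf\<close>

text \<open>
  Continuous sections are those that are locally of the form \<open>gsec A (U, s)\<close>. A continuous section \<open>\<sigma>\<close>
  coincides with \<open>gsec A a\<close> on the preimage of the basic open set \<open>gsec A a ` Uset A a\<close>, because both are
  sections of the first projection. Conversely, if \<open>\<sigma>\<close> is locally of this form and meets a basic open
  set \<open>gsec A b ` Z\<close> over \<open>f y\<close>, then the local expression of \<open>\<sigma>\<close> has the same germ as \<open>b\<close> at \<open>y\<close>, hence at all
  nearby points, and \<open>\<sigma>\<close> stays in that set.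
\<close>

lemma section_iff:
  assumes W: "openin front_pt W"
  shows "\<sigma> \<in> sections (Esheaf A) W \<longleftrightarrow> \<sigma> \<in> extensional W \<and>
    (\<forall>y\<in>pre W. \<exists>U s N. (U, s) \<in> carrier A \<and> openin (front Y) N \<and> y \<in> N \<and> N \<subseteq> pre W \<inter> U \<and>
      (\<forall>z\<in>N. \<sigma> (f z) = gsec A (U, s) (f z)))" (is "_ \<longleftrightarrow> _ \<and> ?local")
proof -
  have mem: "\<sigma> \<in> sections (Esheaf A) W \<longleftrightarrow> \<sigma> \<in> extensional W \<and>
      continuous_map (subtopology front_pt W) (Espace A) \<sigma> \<and> (\<forall>p\<in>W. fst (\<sigma> p) = p)"
    by (simp add: Esheaf_def)
  let ?B = "{gsec A a ` Z |a Z. a \<in> carrier A \<and> Z \<subseteq> Uset A a \<and> locally_closedin (Yspace A) Z}"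
  have tW: "topspace (subtopology front_pt W) = W" using openin_subset[OF W] by auto
  have UB: "gsec A a ` Uset A a \<in> ?B" if a: "a \<in> carrier A" for a
  proof -
    obtain U s where "a = (U, s)" by fastforce
    then have "openin (Yspace A) (Uset A a)"
      using a by (auto simp: openin_Yspace Uset_A carrier_A)
    then show ?thesis using a openin_imp_locally_closedin by blast
  qed
  show ?thesis
  proof
    assume \<sigma>: "\<sigma> \<in> sections (Esheaf A) W"
    have ?local
    proof
      fix y assume y: "y \<in> pre W"
      have cont: "continuous_map (subtopology front_pt W) (Espace A) \<sigma>" using \<sigma> mem by blast
      have fst_\<sigma>: "fst (\<sigma> p) = p" if "p \<in> W" for p using \<sigma> mem that by blast
      have "\<sigma> (f y) \<in> topspace (Espace A)"
        using continuous_map_image_subset_topspace[OF cont] y tW by (auto simp: mem_pre)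
      then have "\<sigma> (f y) \<in> \<Union>?B"
        unfolding Espace_def topology_generated_by_topspace .
      then obtain a p where a: "a \<in> carrier A" "p \<in> Uset A a" "\<sigma> (f y) = gsec A a p" by blast
      obtain U s where Us: "a = (U, s)" by fastforce
      define Z where "Z = {q \<in> topspace (subtopology front_pt W). \<sigma> q \<in> gsec A a ` Uset A a}"
      have "openin (Espace A) (gsec A a ` Uset A a)"
        unfolding Espace_def by (rule topology_generated_by_Basis[OF UB[OF a(1)]])
      then have "openin (subtopology front_pt W) Z"
        unfolding Z_def by (rule openin_continuous_map_preimage[OF cont])
      then have oZ: "openin front_pt Z" and ZW: "Z \<subseteq> W"
        using openin_open_subtopology[OF W] by auto
      have Z: "q \<in> Uset A a \<and> \<sigma> q = gsec A a q" if q: "q \<in> Z" for q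
      proof -
        obtain q' where q': "q' \<in> Uset A a" "\<sigma> q = gsec A a q'" using q by (auto simp: Z_def)
        have "q' = q" using fst_gsec[OF q'(1)] fst_\<sigma>[of q] q'(2) q ZW by auto
        then show ?thesis using q' by simp
      qed
      have "y \<in> pre Z" using y a tW by (auto simp: Z_def mem_pre)
      moreover have "z \<in> pre W \<inter> U" if "z \<in> pre Z" for z
        using ZW Z[of "f z"] a(1) f_in_Uset[of z U s] that unfolding Us by (auto simp: mem_pre)
      moreover have "\<forall>z\<in>pre Z. \<sigma> (f z) = gsec A (U, s) (f z)"
        using Z unfolding Us by (simp add: mem_pre)
      ultimately show "\<exists>U s N. (U, s) \<in> carrier A \<and> openin (front Y) N \<and> y \<in> N \<and> N \<subseteq> pre W \<inter> U \<and>
          (\<forall>z\<in>N. \<sigma> (f z) = gsec A (U, s) (f z))"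
        using a(1) openin_pre[OF oZ] unfolding Us by blast
    qed
    then show "\<sigma> \<in> extensional W \<and> ?local" using \<sigma> mem by blast
  next
    assume R: "\<sigma> \<in> extensional W \<and> ?local"
    have loc: "\<exists>y U s N. p = f y \<and> (U, s) \<in> carrier A \<and> openin (front Y) N \<and> y \<in> N \<and>
        N \<subseteq> pre W \<inter> U \<and> (\<forall>z\<in>N. \<sigma> (f z) = gsec A (U, s) (f z))" if p: "p \<in> W" for p
    proof -
      obtain y where y: "y \<in> pre W" "p = f y" using image_pre[OF W p] .
      then show ?thesis using R by blast
    qed
    have in_Uset: "f z \<in> Uset A (U, s)" if "(U, s) \<in> carrier A" "N \<subseteq> pre W \<inter> U" "z \<in> N" for U s N z
      using subsetD[OF that(2,3)] f_in_Uset[OF _ that(1)] by (auto simp: mem_pre)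
    have val: "\<sigma> p \<in> \<Union>?B \<and> fst (\<sigma> p) = p" if p: "p \<in> W" for p
    proof -
      obtain y U s N where l: "p = f y" "(U, s) \<in> carrier A" "y \<in> N" "N \<subseteq> pre W \<inter> U"
          "\<forall>z\<in>N. \<sigma> (f z) = gsec A (U, s) (f z)"
        using loc[OF p] by blast
      have u: "f y \<in> Uset A (U, s)" using in_Uset l by blast
      have "\<sigma> p = gsec A (U, s) (f y)" using l by blast
      then show ?thesis using UB[OF l(2)] u fst_gsec[OF u] l(1) by auto
    qed
    have "continuous_map (subtopology front_pt W) (Espace A) \<sigma>"
      unfolding Espace_def
    proof (rule continuous_on_generated_topo)
      show "\<sigma> ` topspace (subtopology front_pt W) \<subseteq> \<Union>?B" unfolding tW using val by blast
      fix S assume "S \<in> ?B"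
      then obtain b Z where b: "b \<in> carrier A" "Z \<subseteq> Uset A b" "locally_closedin (Yspace A) Z"
          and S: "S = gsec A b ` Z" by blast
      obtain V t where Vt: "b = (V, t)" by fastforce
      have oZ: "openin (front Y) (pre Z)"
        using b(3) by (intro openin_pre locally_closedin_imp_openin_front)
      have "\<exists>T. openin front_pt T \<and> p \<in> T \<and> T \<subseteq> \<sigma> -` S \<inter> W" if p: "p \<in> \<sigma> -` S \<inter> W" for p
      proof -
        obtain y U s N where l: "p = f y" "(U, s) \<in> carrier A" "openin (front Y) N" "y \<in> N"
            "N \<subseteq> pre W \<inter> U" "\<forall>z\<in>N. \<sigma> (f z) = gsec A (U, s) (f z)"
          using loc p by blast
        have \<sigma>y: "\<sigma> p = gsec A (U, s) (f y)" using l by blast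
        obtain q where q: "q \<in> Z" "\<sigma> p = gsec A b q" using p S by auto
        have "f y \<in> Uset A (U, s)" using in_Uset l by blast
        then have "q = f y"
          using fst_gsec[of q b] fst_gsec[of "f y" "(U, s)"] q \<sigma>y b(2) by auto
        then have fy: "f y \<in> Z" "gsec A (U, s) (f y) = gsec A (V, t) (f y)"
          using q \<sigma>y Vt by auto
        have yT: "y \<in> topspace Y" "y \<in> U" using l by (auto simp: mem_pre)
        have yV: "y \<in> V" using fy(1) b(1,2) f_in_Uset[OF yT(1)] unfolding Vt by blast
        have "same_germ y U s V t"
          using gsec_eq_iff[OF l(2) _ yT(2) yV] b(1) fy(2) unfolding Vt by blast
        then obtain M where M: "openin (front Y) M" "y \<in> M" "M \<subseteq> U \<inter> V" "res E U M s = res E V M t"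
          by (auto simp: same_germ_def)
        let ?T = "N \<inter> M \<inter> pre Z"
        have "f z \<in> \<sigma> -` S \<inter> W" if z: "z \<in> ?T" for z
        proof -
          have "same_germ z U s V t" using M z by (auto simp: same_germ_def)
          then have "gsec A (U, s) (f z) = gsec A (V, t) (f z)"
            using gsec_eq_iff[OF l(2), of V t z] b(1) M(3) z unfolding Vt by auto
          then have "\<sigma> (f z) = gsec A b (f z)" using l(6) z Vt by auto
          then show ?thesis using z S l(5) by (auto simp: mem_pre)
        qed
        moreover have "openin front_pt (f ` ?T)"
          using l(3) M(1) oZ by (intro openin_f_image openin_Int)
        moreover have "p \<in> f ` ?T" using l M fy yT by (auto simp: mem_pre)
        ultimately show ?thesis by (intro exI[of _ "f ` ?T"]) blast
      qed
      then have "openin front_pt (\<sigma> -` S \<inter> W)" by (subst openin_subopen) blast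
      then show "openin (subtopology front_pt W) (\<sigma> -` S \<inter> topspace (subtopology front_pt W))"
        unfolding tW openin_open_subtopology[OF W] by blast
    qed
    then show "\<sigma> \<in> sections (Esheaf A) W" using mem R val by blast
  qed
qed

text \<open>
  A section \<open>\<sigma>\<close> of the sheaf of \<open>A\<close> over \<open>W\<close> and a section \<open>t\<close> of \<open>E\<close> over the preimage of \<open>W\<close> correspond
  to each other when their germs do at every point. This germwise form of the condition that defines
  \<open>natural_sheaf_hom\<close> makes gluing, naturality and bijectivity easy to check.
\<close>

definition represents ::
    "(('a set \<times> 's) set \<Rightarrow> bool) set \<Rightarrow>
     ((('a set \<times> 's) set \<Rightarrow> bool) \<Rightarrow> (('a set \<times> 's) set \<Rightarrow> bool) \<times> ('a set \<times> 's) set) \<Rightarrow> 's \<Rightarrow> bool"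
  where
  "represents W \<sigma> t \<longleftrightarrow> t \<in> sections E (pre W) \<and>
     (\<forall>U s y. (U, s) \<in> carrier A \<and> y \<in> pre W \<inter> U \<and> \<sigma> (f y) = gsec A (U, s) (f y) \<longrightarrow>
        same_germ y (pre W) t U s)"

lemma representsD:
  "represents W \<sigma> t \<Longrightarrow> (U, s) \<in> carrier A \<Longrightarrow> y \<in> pre W \<Longrightarrow> y \<in> U \<Longrightarrow>
     \<sigma> (f y) = gsec A (U, s) (f y) \<Longrightarrow> same_germ y (pre W) t U s"
  unfolding represents_def by blast

lemma local_form:
  assumes "openin front_pt W" "\<sigma> \<in> sections (Esheaf A) W" "y \<in> pre W"
  obtains U s N where "(U, s) \<in> carrier A" "openin (front Y) N" "y \<in> N" "N \<subseteq> pre W \<inter> U"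
    "\<And>z. z \<in> N \<Longrightarrow> \<sigma> (f z) = gsec A (U, s) (f z)"
proof -
  have "\<exists>U s N. (U, s) \<in> carrier A \<and> openin (front Y) N \<and> y \<in> N \<and> N \<subseteq> pre W \<inter> U \<and>
      (\<forall>z\<in>N. \<sigma> (f z) = gsec A (U, s) (f z))"
    using assms(2,3) unfolding section_iff[OF assms(1)] by (elim conjE bspec)
  then show ?thesis using that by (elim exE conjE) auto
qed

lemma represents_unique:
  assumes W: "openin front_pt W" and \<sigma>: "\<sigma> \<in> sections (Esheaf A) W"
    and t: "represents W \<sigma> t" "represents W \<sigma> t'"
  shows "t = t'"
proof -
  have oW: "openin (front Y) (pre W)" using W by (rule openin_pre)
  have sec: "t \<in> sections E (pre W)" "t' \<in> sections E (pre W)" using t by (auto simp: represents_def)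
  have "res E (pre W) (pre W) t = res E (pre W) (pre W) t'"
  proof (rule res_eqI[OF oW oW oW order_refl order_refl sec])
    fix y assume y: "y \<in> pre W"
    obtain U s N where l: "(U, s) \<in> carrier A" "y \<in> N" "N \<subseteq> pre W \<inter> U"
        "\<And>z. z \<in> N \<Longrightarrow> \<sigma> (f z) = gsec A (U, s) (f z)"
      using local_form[OF W \<sigma> y] by metis
    then have g: "same_germ y (pre W) t U s" "same_germ y (pre W) t' U s"
      using l(2,3) t[THEN representsD, OF l(1) _ _ l(4)] by blast+
    show "same_germ y (pre W) t (pre W) t'"
      using carrier_A_front[OF l(1)]
      by (intro same_germ_trans[OF oW _ oW sec(1) _ sec(2) g(1) same_germ_sym[OF g(2)]]) auto
  qed
  then show ?thesis using res_self[OF oW] sec by simp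
qed

text \<open>
  The local expressions of \<open>\<sigma>\<close> agree on overlaps, because equal values of \<open>gsec\<close> are equal germs; the
  sections of \<open>E\<close> that they name therefore glue.
\<close>

lemma represents_exists:
  assumes W: "openin front_pt W" and \<sigma>: "\<sigma> \<in> sections (Esheaf A) W"
  shows "\<exists>t. represents W \<sigma> t"
proof -
  have oW: "openin (front Y) (pre W)" using W by (rule openin_pre)
  define I where "I = {(N, U, s). (U, s) \<in> carrier A \<and> openin (front Y) N \<and> N \<subseteq> pre W \<inter> U \<and>
    (\<forall>z\<in>N. \<sigma> (f z) = gsec A (U, s) (f z))}"
  let ?N = "\<lambda>(N, U, s). N" and ?s = "\<lambda>(N, U, s). res E U N s"
  have cover: "\<Union>(?N ` I) = pre W"
  proof (intro equalityI subsetI)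
    fix y assume "y \<in> \<Union>(?N ` I)"
    then show "y \<in> pre W" by (auto simp: I_def)
  next
    fix y assume y: "y \<in> pre W"
    obtain U s N where l: "(U, s) \<in> carrier A" "openin (front Y) N" "y \<in> N" "N \<subseteq> pre W \<inter> U"
        "\<And>z. z \<in> N \<Longrightarrow> \<sigma> (f z) = gsec A (U, s) (f z)"
      using local_form[OF W \<sigma> y] by metis
    then have "(N, U, s) \<in> I" by (auto simp: I_def)
    then show "y \<in> \<Union>(?N ` I)" using l(3) by force
  qed
  have "\<exists>!t. t \<in> sections E (\<Union>(?N ` I)) \<and> (\<forall>i\<in>I. res E (\<Union>(?N ` I)) (?N i) t = ?s i)"
  proof (rule glue)
    fix i assume i: "i \<in> I"
    obtain N U s where e: "i = (N, U, s)" by (cases i) auto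
    have "openin (front Y) U" "s \<in> sections E U" "openin (front Y) N" "N \<subseteq> U"
      using i carrier_A_front unfolding e I_def by auto
    then show "openin (front Y) (?N i)" "?s i \<in> sections E (?N i)"
      unfolding e by (auto intro: res_closed)
    fix j assume j: "j \<in> I"
    obtain M V t where e': "j = (M, V, t)" by (cases j) auto
    have a: "(U, s) \<in> carrier A" "(V, t) \<in> carrier A" "openin (front Y) N" "openin (front Y) M"
        "N \<subseteq> U" "M \<subseteq> V" "\<And>z. z \<in> N \<Longrightarrow> \<sigma> (f z) = gsec A (U, s) (f z)"
        "\<And>z. z \<in> M \<Longrightarrow> \<sigma> (f z) = gsec A (V, t) (f z)"
      using i j unfolding e e' I_def by auto
    have o: "openin (front Y) (N \<inter> M)" using a by blast
    have "same_germ z U s V t" if "z \<in> N \<inter> M" for z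
      using gsec_eq_iff[OF a(1,2), of z] a(5,6) a(7)[of z] a(8)[of z] that by force
    then have "res E U (N \<inter> M) s = res E V (N \<inter> M) t"
      using a o carrier_A_front by (intro res_eqI) auto
    then show "res E (?N i) (?N i \<inter> ?N j) (?s i) = res E (?N j) (?N i \<inter> ?N j) (?s j)"
      unfolding e e' using res_res[of U N "N \<inter> M" s] res_res[of V M "N \<inter> M" t] a o carrier_A_front
      by simp
  qed
  then obtain t where t: "t \<in> sections E (pre W)" "\<And>i. i \<in> I \<Longrightarrow> res E (pre W) (?N i) t = ?s i"
    unfolding cover by blast
  have "same_germ y (pre W) t U s"
    if a: "(U, s) \<in> carrier A" and y: "y \<in> pre W" "y \<in> U" and eq: "\<sigma> (f y) = gsec A (U, s) (f y)" for U s y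
  proof -
    obtain V r N where l: "(V, r) \<in> carrier A" "openin (front Y) N" "y \<in> N" "N \<subseteq> pre W \<inter> V"
        "\<And>z. z \<in> N \<Longrightarrow> \<sigma> (f z) = gsec A (V, r) (f z)"
      using local_form[OF W \<sigma> y(1)] by metis
    then have "(N, V, r) \<in> I" by (auto simp: I_def)
    then have "same_germ y (pre W) t V r"
      unfolding same_germ_def using t(2)[of "(N, V, r)"] l by auto
    moreover have "same_germ y V r U s"
      using gsec_eq_iff[OF l(1) a, of y] l(3,4) l(5)[OF l(3)] y eq by auto
    ultimately show ?thesis
      using same_germ_trans[OF oW _ _ t(1)] carrier_A_front[OF l(1)] carrier_A_front[OF a] by blast
  qed
  then show ?thesis using t(1) by (auto simp: represents_def)
qed

text \<open>
  The right-hand side is the condition in the definition of \<open>natural_sheaf_hom\<close>.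
\<close>

lemma represents_iff:
  assumes W: "openin front_pt W" and \<sigma>: "\<sigma> \<in> sections (Esheaf A) W"
  shows "represents W \<sigma> t \<longleftrightarrow> t \<in> sections E (pre W) \<and>
    (\<forall>(U, s)\<in>carrier A. \<forall>Z. openin front_pt Z \<and> Z \<subseteq> W \<inter> Uset A (U, s) \<and>
       (\<forall>p\<in>Z. \<sigma> p = gsec A (U, s) p) \<longrightarrow> res E (pre W) (pre Z) t = res E U (pre Z) s)"
    (is "_ \<longleftrightarrow> _ \<and> ?R")
proof
  have oW: "openin (front Y) (pre W)" using W by (rule openin_pre)
  assume t: "represents W \<sigma> t"
  then have tW: "t \<in> sections E (pre W)" by (simp add: represents_def)
  have "res E (pre W) (pre Z) t = res E U (pre Z) s"
    if a: "(U, s) \<in> carrier A" and Z: "openin front_pt Z" "Z \<subseteq> W \<inter> Uset A (U, s)"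
      and eq: "\<forall>p\<in>Z. \<sigma> p = gsec A (U, s) p" for U s Z
  proof -
    have sub: "pre Z \<subseteq> pre W" "pre Z \<subseteq> U"
      using Z f_in_Uset[OF _ a] by (auto simp: mem_pre)
    have "same_germ y (pre W) t U s" if "y \<in> pre Z" for y
      using that sub eq by (intro representsD[OF t a]) (auto simp: mem_pre)
    then show ?thesis
      using oW openin_pre[OF Z(1)] sub tW carrier_A_front[OF a] by (intro res_eqI) auto
  qed
  then show "t \<in> sections E (pre W) \<and> ?R" using tW by auto
next
  have oW: "openin (front Y) (pre W)" using W by (rule openin_pre)
  assume R: "t \<in> sections E (pre W) \<and> ?R"
  have "same_germ y (pre W) t U s"
    if a: "(U, s) \<in> carrier A" and y: "y \<in> pre W" "y \<in> U" and eq: "\<sigma> (f y) = gsec A (U, s) (f y)" for U s y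
  proof -
    obtain V r N where l: "(V, r) \<in> carrier A" "openin (front Y) N" "y \<in> N" "N \<subseteq> pre W \<inter> V"
        "\<And>z. z \<in> N \<Longrightarrow> \<sigma> (f z) = gsec A (V, r) (f z)"
      using local_form[OF W \<sigma> y(1)] by metis
    have NT: "N \<subseteq> topspace Y" using l(4) by (auto simp: mem_pre)
    have "f z \<in> W \<inter> Uset A (V, r)" if "z \<in> N" for z
      using subsetD[OF l(4) that] f_in_Uset[OF _ l(1)] by (auto simp: mem_pre)
    then have "f ` N \<subseteq> W \<inter> Uset A (V, r)" by blast
    moreover have "\<forall>p\<in>f ` N. \<sigma> p = gsec A (V, r) p" using l(5) by blast
    ultimately have "res E (pre W) (pre (f ` N)) t = res E V (pre (f ` N)) r"
      using R l(1) openin_f_image[OF l(2)] by blast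
    then have "same_germ y (pre W) t V r"
      unfolding same_germ_def pre_image[OF NT] using l by auto
    moreover have "same_germ y V r U s"
      using gsec_eq_iff[OF l(1) a, of y] l(3,4) l(5)[OF l(3)] y eq by auto
    ultimately show ?thesis
      using same_germ_trans[OF oW, of V U t r s y] R carrier_A_front[OF l(1)] carrier_A_front[OF a] by blast
  qed
  then show "represents W \<sigma> t" using R by (auto simp: represents_def)
qed

section \<open>The natural sheaf morphism\<close>

definition nat_hom where "nat_hom = natural_sheaf_hom (Y, E)"

lemma nat_hom_eq_iff:
  assumes W: "openin front_pt W" and \<sigma>: "\<sigma> \<in> sections (Esheaf A) W"
  shows "nat_hom W \<sigma> = t \<longleftrightarrow> represents W \<sigma> t"
proof -
  have "nat_hom W \<sigma> = (THE t. represents W \<sigma> t)"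
    unfolding represents_iff[OF W \<sigma>] unfolding nat_hom_def A_def f_def natural_sheaf_hom.simps Let_def ..
  moreover have "\<exists>!t. represents W \<sigma> t"
    using represents_exists[OF W \<sigma>] represents_unique[OF W \<sigma>] by blast
  ultimately show ?thesis using theI'[of "represents W \<sigma>"] by metis
qed

lemma sheaf_hom_nat_hom: "sheaf_hom front_pt (Esheaf A) (pushforward Y f E) nat_hom"
  unfolding sheaf_hom_def
proof (intro conjI allI impI ballI)
  fix W assume "openin front_pt W"
  then show "nat_hom W \<in> sections (Esheaf A) W \<rightarrow> sections (pushforward Y f E) W"
    using nat_hom_eq_iff[of W] by (auto simp: pushforward_def represents_def)
next
  fix W V \<sigma> assume a: "openin front_pt W \<and> openin front_pt V \<and> V \<subseteq> W" and \<sigma>: "\<sigma> \<in> sections (Esheaf A) W"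
  let ?t = "nat_hom W \<sigma>"
  have \<sigma>V: "restrict \<sigma> V \<in> sections (Esheaf A) V"
  proof -
    have "res (Esheaf A) W V \<sigma> \<in> sections (Esheaf A) V"
      using sheaf_on.res_closed[OF sheaf_on.intro[OF sheaf_Esheaf[of A]]] a \<sigma> by blast
    moreover have "res (Esheaf A) W V \<sigma> = restrict \<sigma> V" by (simp add: Esheaf_def)
    ultimately show ?thesis by simp
  qed
  have o: "openin (front Y) (pre W)" "openin (front Y) (pre V)" and sub: "pre V \<subseteq> pre W"
    using a openin_pre by (auto simp: mem_pre)
  have t: "represents W \<sigma> ?t" using nat_hom_eq_iff a \<sigma> by blast
  then have tW: "?t \<in> sections E (pre W)" by (simp add: represents_def)
  have tV: "res E (pre W) (pre V) ?t \<in> sections E (pre V)" using o sub tW by (intro res_closed)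
  have "same_germ y (pre V) (res E (pre W) (pre V) ?t) U s"
    if b: "(U, s) \<in> carrier A" and y: "y \<in> pre V" "y \<in> U" and eq: "restrict \<sigma> V (f y) = gsec A (U, s) (f y)"
    for U s y
  proof -
    have "\<sigma> (f y) = gsec A (U, s) (f y)" using eq y by (simp add: mem_pre)
    then have "same_germ y (pre W) ?t U s"
      using y sub by (intro representsD[OF t b]) auto
    moreover have "same_germ y (pre V) (res E (pre W) (pre V) ?t) (pre W) ?t"
      using same_germ_sym[OF same_germ_res[OF o sub tW y(1)]] .
    ultimately show ?thesis
      using same_germ_trans[OF o(2,1) _ tV tW] carrier_A_front[OF b] by blast
  qed
  then have "represents V (restrict \<sigma> V) (res E (pre W) (pre V) ?t)"
    using tV by (auto simp: represents_def)
  then have "nat_hom V (restrict \<sigma> V) = res E (pre W) (pre V) ?t"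
    using nat_hom_eq_iff \<sigma>V a by blast
  then show "nat_hom V (res (Esheaf A) W V \<sigma>) = res (pushforward Y f E) W V ?t"
    by (simp add: Esheaf_def pushforward_def)
qed

text \<open>
  At each point the value of \<open>\<sigma>\<close> is the germ of its image, since both are the germ of a local
  expression of \<open>\<sigma>\<close>.
\<close>

lemma nat_hom_inj:
  assumes W: "openin front_pt W"
  shows "inj_on (nat_hom W) (sections (Esheaf A) W)"
proof (rule inj_onI)
  have oW: "openin (front Y) (pre W)" using W by (rule openin_pre)
  fix \<sigma> \<tau> assume \<sigma>: "\<sigma> \<in> sections (Esheaf A) W" and \<tau>: "\<tau> \<in> sections (Esheaf A) W"
    and eq: "nat_hom W \<sigma> = nat_hom W \<tau>"
  let ?t = "nat_hom W \<sigma>"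
  have r: "represents W \<sigma> ?t" "represents W \<tau> ?t"
    using nat_hom_eq_iff[OF W \<sigma>] nat_hom_eq_iff[OF W \<tau>] eq by auto
  then have tW: "?t \<in> sections E (pre W)" by (simp add: represents_def)
  show "\<sigma> = \<tau>"
  proof (rule extensionalityI[of _ W])
    show "\<sigma> \<in> extensional W" "\<tau> \<in> extensional W" using \<sigma> \<tau> by (auto simp: Esheaf_def)
    fix p assume "p \<in> W"
    then obtain y where y: "y \<in> pre W" "p = f y" using image_pre[OF W] by metis
    obtain U s N where l: "(U, s) \<in> carrier A" "y \<in> N" "N \<subseteq> pre W \<inter> U"
        "\<And>z. z \<in> N \<Longrightarrow> \<sigma> (f z) = gsec A (U, s) (f z)"
      using local_form[OF W \<sigma> y(1)] by metis
    obtain V r M where m: "(V, r) \<in> carrier A" "y \<in> M" "M \<subseteq> pre W \<inter> V"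
        "\<And>z. z \<in> M \<Longrightarrow> \<tau> (f z) = gsec A (V, r) (f z)"
      using local_form[OF W \<tau> y(1)] by metis
    have g: "same_germ y (pre W) ?t U s" "same_germ y (pre W) ?t V r"
      using l(2,3) m(2,3) representsD[OF r(1) l(1) _ _ l(4)] representsD[OF r(2) m(1) _ _ m(4)] by blast+
    have "same_germ y U s V r"
      using carrier_A_front[OF l(1)] carrier_A_front[OF m(1)]
      by (intro same_germ_trans[OF _ oW _ _ tW _ same_germ_sym[OF g(1)] g(2)]) auto
    then have "gsec A (U, s) (f y) = gsec A (V, r) (f y)"
      using gsec_eq_iff[OF l(1) m(1), of y] l(2,3) m(2,3) by blast
    then show "\<sigma> p = \<tau> p" using l m y(2) by simp
  qed
qed

text \<open>
  By \<open>extend_germ\<close> every germ of \<open>t\<close> is the germ of some element \<open>c y\<close> of \<open>A\<close>; the section sought takes the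
  value of \<open>gsec A (c y)\<close> at \<open>f y\<close>. Although \<open>c y\<close> varies without any continuity, this value depends
  only on the germ of \<open>t\<close> at \<open>y\<close>, so near \<open>y\<close> the one element \<open>c y\<close> serves for all points.
\<close>

lemma nat_hom_surj:
  assumes W: "openin front_pt W" and t: "t \<in> sections E (pre W)"
  shows "\<exists>\<sigma>\<in>sections (Esheaf A) W. nat_hom W \<sigma> = t"
proof -
  have oW: "openin (front Y) (pre W)" using W by (rule openin_pre)
  have "\<exists>c. c \<in> carrier A \<and> y \<in> fst c \<and> same_germ y (pre W) t (fst c) (snd c)" if y: "y \<in> pre W" for y
  proof -
    obtain U r where "openin Y U" "r \<in> sections E U" "y \<in> U" "same_germ y (pre W) t U r"
      using extend_germ[OF oW t y] .
    then show ?thesis by (intro exI[of _ "(U, r)"]) (simp add: carrier_A)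
  qed
  then obtain c where c: "\<And>y. y \<in> pre W \<Longrightarrow> c y \<in> carrier A \<and> y \<in> fst (c y) \<and>
      same_germ y (pre W) t (fst (c y)) (snd (c y))"
    by metis
  define \<sigma> where "\<sigma> = (\<lambda>p\<in>W. gsec A (c (inv_into (topspace Y) f p)) p)"
  have \<sigma>f: "\<sigma> (f y) = gsec A (c y) (f y)" if "y \<in> pre W" for y
    using that f_bij by (simp add: \<sigma>_def mem_pre bij_betw_def inv_into_f_f)
  have germ_iff: "\<sigma> (f y) = gsec A (U, s) (f y) \<longleftrightarrow> same_germ y (pre W) t U s"
    if a: "(U, s) \<in> carrier A" and y: "y \<in> pre W" "y \<in> U" for U s y
  proof -
    obtain V r where Vr: "c y = (V, r)" by fastforce
    have v: "(V, r) \<in> carrier A" "y \<in> V" "same_germ y (pre W) t V r"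
      using c[OF y(1)] unfolding Vr by auto
    have f: "openin (front Y) V" "r \<in> sections E V" "openin (front Y) U" "s \<in> sections E U"
      using carrier_A_front v(1) a by auto
    have "\<sigma> (f y) = gsec A (U, s) (f y) \<longleftrightarrow> same_germ y V r U s"
      unfolding \<sigma>f[OF y(1)] Vr using gsec_eq_iff[OF v(1) a v(2) y(2)] .
    also have "\<dots> \<longleftrightarrow> same_germ y (pre W) t U s"
      using same_germ_trans[OF oW f(1,3) t f(2,4) v(3)]
        same_germ_trans[OF f(1) oW f(3) f(2) t f(4) same_germ_sym[OF v(3)]] by blast
    finally show ?thesis .
  qed
  have \<sigma>: "\<sigma> \<in> sections (Esheaf A) W"
    unfolding section_iff[OF W]
  proof (intro conjI ballI)
    show "\<sigma> \<in> extensional W" by (simp add: \<sigma>_def)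
    fix y assume y: "y \<in> pre W"
    obtain U s where Us: "c y = (U, s)" by fastforce
    have a: "(U, s) \<in> carrier A" "same_germ y (pre W) t U s" using c[OF y] unfolding Us by auto
    obtain N where N: "openin (front Y) N" "y \<in> N" "N \<subseteq> pre W \<inter> U" "res E (pre W) N t = res E U N s"
      using a(2) by (auto simp: same_germ_def)
    have "\<sigma> (f z) = gsec A (U, s) (f z)" if z: "z \<in> N" for z
    proof -
      have "same_germ z (pre W) t U s" using N z by (auto simp: same_germ_def)
      then show ?thesis using germ_iff[OF a(1), of z] N(3) z by blast
    qed
    then show "\<exists>U s N. (U, s) \<in> carrier A \<and> openin (front Y) N \<and> y \<in> N \<and> N \<subseteq> pre W \<inter> U \<and>
        (\<forall>z\<in>N. \<sigma> (f z) = gsec A (U, s) (f z))"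
      using a(1) N(1-3) by blast
  qed
  moreover have "represents W \<sigma> t"
    using t germ_iff by (auto simp: represents_def)
  ultimately show ?thesis using nat_hom_eq_iff[OF W] by blast
qed

lemma sober_sheaf_of_sober_space: "sober_sheaf (Y, E)"
proof -
  obtain g where g: "homeomorphic_maps Y (Yspace A) f g"
    using homeomorphic_f homeomorphic_map_maps by blast
  have bij: "bij_betw (nat_hom W) (sections (Esheaf A) W) (sections E (pre W))" if W: "openin front_pt W" for W
    unfolding bij_betw_def
  proof (intro conjI equalityI subsetI)
    show "inj_on (nat_hom W) (sections (Esheaf A) W)" using W by (rule nat_hom_inj)
    fix t assume "t \<in> nat_hom W ` sections (Esheaf A) W"
    then show "t \<in> sections E (pre W)"
      using nat_hom_eq_iff[OF W] by (auto simp: represents_def)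
  next
    fix t assume "t \<in> sections E (pre W)"
    then show "t \<in> nat_hom W ` sections (Esheaf A) W" using nat_hom_surj[OF W] by blast
  qed
  have "pre (topspace front_pt) = topspace (front Y)"
    using f_in_points by (auto simp: mem_pre topspace_front topspace_Yspace)
  then have "sections (Esheaf A) (topspace front_pt) \<noteq> {}"
    using global_section bij[OF openin_topspace] by (auto simp: bij_betw_def)
  then have "Sh_morphism (Y, E) (Yspace A, Esheaf A) (f, nat_hom)"
    using sheaf global_section sheaf_Esheaf sheaf_hom_nat_hom
      homeomorphic_imp_continuous_map[OF homeomorphic_f] by simp
  then have "Sh_iso (Y, E) (Yspace A, Esheaf A) (f, nat_hom)"
    using g bij by (rule Sh_isoI)
  then show ?thesis
    unfolding sober_sheaf_def G_def A_def f_def nat_hom_def .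
qed

end

section \<open>Sobriety of the sheaf and of the space\<close>

theorem proposition3p10:
  fixes Y :: "'a topology" and E :: "('a, 's) presheaf"
  assumes "Sh_object (Y, E)"
  shows "sober_sheaf (Y, E) \<longleftrightarrow> sober_space Y"
proof
  interpret front_object Y E
    using assms by unfold_locales auto
  assume "sober_sheaf (Y, E)"
  then obtain g m where gm: "Sh_morphism (Y, E) (Yspace A, Esheaf A) (f, natural_sheaf_hom (Y, E))"
      "Sh_morphism (Yspace A, Esheaf A) (Y, E) (g, m)"
      "Sh_eq (Y, E) (Y, E) (Sh_comp (Yspace A) (g, m) (f, natural_sheaf_hom (Y, E))) Sh_id"
      "Sh_eq (Yspace A, Esheaf A) (Yspace A, Esheaf A) (Sh_comp Y (f, natural_sheaf_hom (Y, E)) (g, m)) Sh_id"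
    unfolding sober_sheaf_def G_def A_def[symmetric] f_def[symmetric] Sh_iso_def by auto
  then have "homeomorphic_maps Y (Yspace A) f g"
    by (auto simp: homeomorphic_maps_def Sh_id_def)
  then have "Y homeomorphic_space pt (Dquot A)"
    unfolding Yspace_def homeomorphic_space_def by blast
  then show "sober_space Y" using frame_Dquot by (intro sober_spaceI)
next
  interpret front_object Y E
    using assms by unfold_locales auto
  assume "sober_space Y"
  then interpret sober_object Y E by unfold_locales
  show "sober_sheaf (Y, E)" by (rule sober_sheaf_of_sober_space)
qed

end
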